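(* Let $G$ be a discrete group acting on itself by conjugation. For $w\in Z^3(G,\mathbb T)$ a normalized 3-cocycle, the cohomology class $$[\alpha_w\oplus\beta_w\oplus\theta_w]\oplus[w]\in H^3(\mathrm{Tot}^*(A^{*,*}(G\rtimes G,\mathbb T)))\oplus H^3(G,\mathbb T)$$ is equal to $\mu^*[w]$, where $\mu:G\rtimes G\to G$, $(a,g)\mapsto ag$, is the multiplication map. Moreover the map $$H^3(G,\mathbb T)\oplus H^3(\mathrm{Tot}^*(B^{*,*}(G\rtimes G,\mathbb T)))\to H^3(\mathrm{Tot}^*(A^{*,*}(G\rtimes G,\mathbb T))),\qquad [w]\oplus[x]\mapsto[\alpha_w\oplus\beta_w\oplus\theta_w]+[x],$$ is an isomorphism.
   Context: $\mathbb T=S^1$, written multiplicatively. $G\rtimes G$ is the set $G\times G$ with $(a,g)(b,h)=(a\,gbg^{-1},gh)$; write $K=G$ for the first factor, with $g(k)=gkg^{-1}$. $C^{p,q}(G\rtimes G,\mathbb T)$ is the group of maps $F:G^p\times K^q\to\mathbb T$, values $F[g_1|\dots|g_p||k_1|\dots|k_q]$, equal to $1$ if some $g_i$ or $k_j$ is $1$ ($C^{0,0}=\mathbb T$), with differentials $(\delta_GF)[g_1|\dots|g_{p+1}||k_1|\dots|k_q]=F[g_2|\dots|g_{p+1}||k_1|\dots|k_q]\prod_{i=1}^pF[\dots|g_ig_{i+1}|\dots||k_1|\dots|k_q]^{(-1)^i}F[g_1|\dots|g_p||g_{p+1}(k_1)|\dots|g_{p+1}(k_q)]^{(-1)^{p+1}}$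 and $(\delta_KF)[g_1|\dots|g_p||k_1|\dots|k_{q+1}]=F[\dots||k_2|\dots|k_{q+1}]\prod_{j=1}^qF[\dots||\dots|k_jk_{j+1}|\dots]^{(-1)^j}F[\dots||k_1|\dots|k_q]^{(-1)^{q+1}}$. Total complexes carry the differential $\delta_G\oplus\delta_K^{(-1)^p}$. The total complex of $C^{*,*}$ computes $H^*(G\rtimes G,\mathbb T)$. $A^{*,*}$ is the sub double complex of the $C^{p,q}$ with $q>0$; $B^{*,*}$ is the sub double complex of the $C^{p,q}$ with $p>0$ and $q>0$; the class $[x]$ is mapped to $H^3(\mathrm{Tot}^*(A^{*,*}))$ via the inclusion $B^{*,*}\subset A^{*,*}$. The row $q=0$ is the normalized bar complex $C^*(G,\mathbb T)$ of the acting group and $C^{*,*}=A^{*,*}\oplus C^{*,0}$ as double complexes, which gives the canonical isomorphism $H^*(G\rtimes G,\mathbb T)\cong H^*(\mathrm{Tot}^*(A^{*,*}(G\rtimes G,\mathbb T)))\oplus H^*(G,\mathbb T)$ used in the statement. The cochains are $$\alpha_w[g|h||x]=\frac{w[g|h|x]\,w[ghxh^{-1}g^{-1}|g|h]}{w[g|hxh^{-1}|h]},\quad\beta_w[g||x|y]=\frac{w[g|x|y]\,w[gxg^{-1}|gyg^{-1}|g]}{w[gxg^{-1}|g|y]},\quad\theta_w[x|y|z]=w[x|y|z],$$ and $\alpha_w\oplus\beta_w\oplus\theta_w$ is a 3-cocycle of $\mathrm{Tot}^*(A^{*,*}(G\rtimes G,\mathbb T))$. *)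

theory Defs
  imports Complex_Main "HOL-Algebra.Coset" "HOL-Algebra.Product_Groups"
begin

section \<open>Cohomology of a cochain complex of abelian groups\<close>

text \<open>A cochain complex is given by its groups \<open>C n\<close> and differentials \<open>d n : C n \<rightarrow> C (n + 1)\<close>.
  Cohomology classes are cosets of the coboundaries.\<close>

definition cocycles :: "(nat \<Rightarrow> 'c monoid) \<Rightarrow> (nat \<Rightarrow> 'c \<Rightarrow> 'c) \<Rightarrow> nat \<Rightarrow> 'c set" where
  "cocycles C d n = kernel (C n) (C (Suc n)) (d n)"

definition coboundaries :: "(nat \<Rightarrow> 'c monoid) \<Rightarrow> (nat \<Rightarrow> 'c \<Rightarrow> 'c) \<Rightarrow> nat \<Rightarrow> 'c set" where
  "coboundaries C d n =
     (case n of 0 \<Rightarrow> {\<one>\<^bsub>C 0\<^esub>} | Suc m \<Rightarrow> d m ` carrier (C m))"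

definition cohomology ::
    "(nat \<Rightarrow> 'c monoid) \<Rightarrow> (nat \<Rightarrow> 'c \<Rightarrow> 'c) \<Rightarrow> nat \<Rightarrow> 'c set monoid" where
  "cohomology C d n = (C n)\<lparr>carrier := cocycles C d n\<rparr> Mod coboundaries C d n"

definition coh_class :: "(nat \<Rightarrow> 'c monoid) \<Rightarrow> (nat \<Rightarrow> 'c \<Rightarrow> 'c) \<Rightarrow> nat \<Rightarrow> 'c \<Rightarrow> 'c set" where
  "coh_class C d n x = coboundaries C d n #>\<^bsub>C n\<^esub> x"

text \<open>The map into the \<open>n\<close>-th cohomology of \<open>(C, d)\<close> induced by a cochain map \<open>\<phi>\<close>. The classes of
  the images of the representatives \<open>x\<close> of \<open>c\<close> all coincide, so the union is that common class.\<close>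

definition induced_map ::
    "(nat \<Rightarrow> 'd monoid) \<Rightarrow> (nat \<Rightarrow> 'd \<Rightarrow> 'd) \<Rightarrow> nat \<Rightarrow> ('c \<Rightarrow> 'd) \<Rightarrow> 'c set \<Rightarrow> 'd set" where
  "induced_map C d n \<phi> c = (\<Union>x\<in>c. coh_class C d n (\<phi> x))"


section \<open>The normalized bar complex with coefficients in the circle\<close>

text \<open>Cochains take values in the unit circle of \<open>complex\<close>. A cochain is a function on all lists;
  off its domain (lists of the wrong length or leaving the carrier) it is fixed to be \<open>1\<close>,
  so that the group operation is pointwise multiplication throughout.\<close>

definition bar :: "('a, 'm) monoid_scheme \<Rightarrow> nat \<Rightarrow> ('a list \<Rightarrow> complex) monoid" where
  "bar G n =
     \<lparr>carrier = {f. (\<forall>gs. cmod (f gs) = 1) \<and>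
                    (\<forall>gs. \<not> (length gs = n \<and> set gs \<subseteq> carrier G) \<longrightarrow> f gs = 1) \<and>
                    (\<forall>gs. \<one>\<^bsub>G\<^esub> \<in> set gs \<longrightarrow> f gs = 1)},
      mult = (\<lambda>f f' gs. f gs * f' gs),
      one = (\<lambda>gs. 1)\<rparr>"

text \<open>\<open>merge G i [g\<^sub>1, \<dots>, g\<^sub>n] = [g\<^sub>1, \<dots>, g\<^sub>i g\<^sub>i\<^sub>+\<^sub>1, \<dots>, g\<^sub>n]\<close>
  for \<open>1 \<le> i < n\<close>; list positions start at \<open>0\<close>.\<close>

definition merge :: "('a, 'm) monoid_scheme \<Rightarrow> nat \<Rightarrow> 'a list \<Rightarrow> 'a list" where
  "merge G i gs = take (i - 1) gs @ [gs ! (i - 1) \<otimes>\<^bsub>G\<^esub> gs ! i] @ drop (i + 1) gs"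

definition bar_d ::
    "('a, 'm) monoid_scheme \<Rightarrow> nat \<Rightarrow> ('a list \<Rightarrow> complex) \<Rightarrow> 'a list \<Rightarrow> complex" where
  "bar_d G n f gs =
     (if length gs = n + 1 \<and> set gs \<subseteq> carrier G
      then f (tl gs) * (\<Prod>i = 1..n. f (merge G i gs) powi ((-1) ^ i))
             * f (butlast gs) powi ((-1) ^ (n + 1))
      else 1)"

abbreviation H_group :: "('a, 'm) monoid_scheme \<Rightarrow> nat \<Rightarrow> ('a list \<Rightarrow> complex) set monoid" where
  "H_group G \<equiv> cohomology (bar G) (bar_d G)"

definition pullback ::
    "('a, 'm) monoid_scheme \<Rightarrow> ('a \<Rightarrow> 'b) \<Rightarrow> nat \<Rightarrow> ('b list \<Rightarrow> complex) \<Rightarrow> 'a list \<Rightarrow> complex" where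
  "pullback H \<phi> n f xs = (if length xs = n \<and> set xs \<subseteq> carrier H then f (map \<phi> xs) else 1)"

definition pullback_class ::
    "('a, 'm) monoid_scheme \<Rightarrow> ('a \<Rightarrow> 'b) \<Rightarrow> nat \<Rightarrow> ('b list \<Rightarrow> complex) set
       \<Rightarrow> ('a list \<Rightarrow> complex) set" where
  "pullback_class H \<phi> n = induced_map (bar H) (bar_d H) n (pullback H \<phi> n)"


section \<open>The semidirect product for the conjugation action\<close>

definition cnj_act :: "('a, 'm) monoid_scheme \<Rightarrow> 'a \<Rightarrow> 'a \<Rightarrow> 'a" where
  "cnj_act G g k = g \<otimes>\<^bsub>G\<^esub> k \<otimes>\<^bsub>G\<^esub> inv\<^bsub>G\<^esub> g"

definition semidirect :: "('a, 'm) monoid_scheme \<Rightarrow> ('a \<times> 'a) monoid" where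
  "semidirect G =
     \<lparr>carrier = carrier G \<times> carrier G,
      mult = (\<lambda>(a, g) (b, h). (a \<otimes>\<^bsub>G\<^esub> cnj_act G g b, g \<otimes>\<^bsub>G\<^esub> h)),
      one = (\<one>\<^bsub>G\<^esub>, \<one>\<^bsub>G\<^esub>)\<rparr>"

definition mu :: "('a, 'm) monoid_scheme \<Rightarrow> 'a \<times> 'a \<Rightarrow> 'a" where
  "mu G = (\<lambda>(a, g). a \<otimes>\<^bsub>G\<^esub> g)"


section \<open>The double complex\<close>

text \<open>\<open>F gs ks\<close> is the value \<open>F[g\<^sub>1|\<dots>|g\<^sub>p||k\<^sub>1|\<dots>|k\<^sub>q]\<close>.\<close>

type_synonym 'a bicochain = "'a list \<Rightarrow> 'a list \<Rightarrow> complex"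

definition Cpq :: "('a, 'm) monoid_scheme \<Rightarrow> nat \<Rightarrow> nat \<Rightarrow> 'a bicochain monoid" where
  "Cpq G p q =
     \<lparr>carrier = {F. (\<forall>gs ks. cmod (F gs ks) = 1) \<and>
                    (\<forall>gs ks. \<not> (length gs = p \<and> length ks = q \<and>
                       set gs \<subseteq> carrier G \<and> set ks \<subseteq> carrier G) \<longrightarrow> F gs ks = 1) \<and>
                    (\<forall>gs ks. \<one>\<^bsub>G\<^esub> \<in> set gs \<union> set ks \<longrightarrow> F gs ks = 1)},
      mult = (\<lambda>F F' gs ks. F gs ks * F' gs ks),
      one = (\<lambda>gs ks. 1)\<rparr>"

definition delta_G ::
    "('a, 'm) monoid_scheme \<Rightarrow> nat \<Rightarrow> nat \<Rightarrow> 'a bicochain \<Rightarrow> 'a bicochain" where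
  "delta_G G p q F gs ks =
     (if length gs = p + 1 \<and> length ks = q \<and> set gs \<subseteq> carrier G \<and> set ks \<subseteq> carrier G
      then F (tl gs) ks * (\<Prod>i = 1..p. F (merge G i gs) ks powi ((-1) ^ i))
             * F (butlast gs) (map (cnj_act G (last gs)) ks) powi ((-1) ^ (p + 1))
      else 1)"

definition delta_K ::
    "('a, 'm) monoid_scheme \<Rightarrow> nat \<Rightarrow> nat \<Rightarrow> 'a bicochain \<Rightarrow> 'a bicochain" where
  "delta_K G p q F gs ks =
     (if length gs = p \<and> length ks = q + 1 \<and> set gs \<subseteq> carrier G \<and> set ks \<subseteq> carrier G
      then F gs (tl ks) * (\<Prod>j = 1..q. F gs (merge G j ks) powi ((-1) ^ j))
             * F gs (butlast ks) powi ((-1) ^ (q + 1))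
      else 1)"

definition Apq :: "('a, 'm) monoid_scheme \<Rightarrow> nat \<Rightarrow> nat \<Rightarrow> 'a bicochain monoid" where
  "Apq G p q =
     (if q > 0 then Cpq G p q else (Cpq G p q)\<lparr>carrier := {\<one>\<^bsub>Cpq G p q\<^esub>}\<rparr>)"

definition Bpq :: "('a, 'm) monoid_scheme \<Rightarrow> nat \<Rightarrow> nat \<Rightarrow> 'a bicochain monoid" where
  "Bpq G p q =
     (if p > 0 \<and> q > 0 then Cpq G p q else (Cpq G p q)\<lparr>carrier := {\<one>\<^bsub>Cpq G p q\<^esub>}\<rparr>)"

text \<open>An element \<open>F\<close> of the total complex in degree \<open>n\<close> has the component \<open>F p\<close> in bidegree
  \<open>(p, n - p)\<close> for \<open>p \<le> n\<close>. The sign of \<open>delta_K\<close> depends on \<open>p\<close> only. The conditions \<open>p > 0\<close> and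
  \<open>p \<le> n\<close> in \<open>Tot_d\<close> discard the sources of bidegree \<open>(-1, n + 1)\<close> and \<open>(n + 1, -1)\<close>.\<close>

definition Tot ::
    "(nat \<Rightarrow> nat \<Rightarrow> 'a bicochain monoid) \<Rightarrow> nat \<Rightarrow> (nat \<Rightarrow> 'a bicochain) monoid" where
  "Tot X n = product_group {..n} (\<lambda>p. X p (n - p))"

definition Tot_d ::
    "('a, 'm) monoid_scheme \<Rightarrow> nat \<Rightarrow> (nat \<Rightarrow> 'a bicochain) \<Rightarrow> nat \<Rightarrow> 'a bicochain" where
  "Tot_d G n F = (\<lambda>p\<in>{..n + 1}. \<lambda>gs ks.
     (if p > 0 then delta_G G (p - 1) (n + 1 - p) (F (p - 1)) gs ks else 1) *
     (if p \<le> n then delta_K G p (n - p) (F p) gs ks powi ((-1) ^ p) else 1))"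

abbreviation H_Tot ::
    "('a, 'm) monoid_scheme \<Rightarrow> (nat \<Rightarrow> nat \<Rightarrow> 'a bicochain monoid) \<Rightarrow> nat
       \<Rightarrow> (nat \<Rightarrow> 'a bicochain) set monoid" where
  "H_Tot G X \<equiv> cohomology (Tot X) (Tot_d G)"


section \<open>The canonical isomorphism\<close>

text \<open>The double complex consists of the cochains on the bisimplicial set \<open>G\<^sup>p \<times> K\<^sup>q\<close>, whose diagonal
  is identified with the nerve of the semidirect product by letting \<open>(g\<^sub>1, \<dots>, g\<^sub>n, k\<^sub>1, \<dots>, k\<^sub>n)\<close>
  correspond to the simplex with entries \<open>((g\<^sub>j \<cdots> g\<^sub>n)(k\<^sub>j), g\<^sub>j)\<close>. The comparison of the bar complex
  of the semidirect product with the total complex is the Eilenberg-Zilber shuffle map. A shuffle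
  is a word in the letters \<open>(1, g\<^sub>i)\<close> and \<open>(k\<^sub>j, 1)\<close>, each family in its given order, where a letter
  \<open>k\<^sub>j\<close> is acted on by the product of the \<open>g\<^sub>i\<close> to its right; the sign counts
  the pairs in which a \<open>k\<^sub>j\<close> precedes a \<open>g\<^sub>i\<close>. The recursion is on the first letter of the word.\<close>

fun shuffle_prod ::
    "('a, 'm) monoid_scheme \<Rightarrow> (('a \<times> 'a) list \<Rightarrow> complex) \<Rightarrow> 'a bicochain" where
  "shuffle_prod G f gs [] = f (map (\<lambda>g. (\<one>\<^bsub>G\<^esub>, g)) gs)"
| "shuffle_prod G f [] (k # ks) = f (map (\<lambda>k. (k, \<one>\<^bsub>G\<^esub>)) (k # ks))"
| "shuffle_prod G f (g # gs) (k # ks) =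
     shuffle_prod G (\<lambda>v. f ((\<one>\<^bsub>G\<^esub>, g) # v)) gs (k # ks) *
     shuffle_prod G
       (\<lambda>v. f ((cnj_act G (foldr (\<otimes>\<^bsub>G\<^esub>) (g # gs) \<one>\<^bsub>G\<^esub>) k, \<one>\<^bsub>G\<^esub>) # v)) (g # gs) ks
         powi ((-1) ^ length (g # gs))"

definition shuffle_map ::
    "('a, 'm) monoid_scheme \<Rightarrow> nat \<Rightarrow> (('a \<times> 'a) list \<Rightarrow> complex) \<Rightarrow> nat \<Rightarrow> 'a bicochain" where
  "shuffle_map G n f = (\<lambda>p\<in>{..n}. \<lambda>gs ks.
     if length gs = p \<and> length ks = n - p \<and> set gs \<subseteq> carrier G \<and> set ks \<subseteq> carrier G
     then shuffle_prod G f gs ks else 1)"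

text \<open>The two projections of the decomposition of the double complex into \<open>Apq\<close> and the row
  \<open>q = 0\<close>, the latter being the bar complex of \<open>G\<close>.\<close>

definition A_part :: "nat \<Rightarrow> (nat \<Rightarrow> 'a bicochain) \<Rightarrow> nat \<Rightarrow> 'a bicochain" where
  "A_part n F = (\<lambda>p\<in>{..n}. if p < n then F p else (\<lambda>gs ks. 1))"

definition row_part :: "nat \<Rightarrow> (nat \<Rightarrow> 'a bicochain) \<Rightarrow> 'a list \<Rightarrow> complex" where
  "row_part n F gs = F n gs []"

definition EZ_class ::
    "('a, 'm) monoid_scheme \<Rightarrow> nat \<Rightarrow> (('a \<times> 'a) list \<Rightarrow> complex) set
       \<Rightarrow> (nat \<Rightarrow> 'a bicochain) set" where
  "EZ_class G n = induced_map (Tot (Cpq G)) (Tot_d G) n (shuffle_map G n)"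

definition split_class ::
    "('a, 'm) monoid_scheme \<Rightarrow> nat \<Rightarrow> (nat \<Rightarrow> 'a bicochain) set
       \<Rightarrow> (nat \<Rightarrow> 'a bicochain) set \<times> ('a list \<Rightarrow> complex) set" where
  "split_class G n c =
     (induced_map (Tot (Apq G)) (Tot_d G) n (A_part n) c,
      induced_map (bar G) (bar_d G) n (row_part n) c)"

definition canonical_iso ::
    "('a, 'm) monoid_scheme \<Rightarrow> nat \<Rightarrow> (('a \<times> 'a) list \<Rightarrow> complex) set
       \<Rightarrow> (nat \<Rightarrow> 'a bicochain) set \<times> ('a list \<Rightarrow> complex) set" where
  "canonical_iso G n = split_class G n \<circ> EZ_class G n"


section \<open>The cochains associated with a 3-cocycle\<close>

definition alpha :: "('a, 'm) monoid_scheme \<Rightarrow> ('a list \<Rightarrow> complex) \<Rightarrow> 'a bicochain" where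
  "alpha G w gs ks = (case (gs, ks) of
      ([g, h], [x]) \<Rightarrow>
        if {g, h, x} \<subseteq> carrier G
        then w [g, h, x] * w [cnj_act G (g \<otimes>\<^bsub>G\<^esub> h) x, g, h] / w [g, cnj_act G h x, h]
        else 1
    | _ \<Rightarrow> 1)"

definition beta :: "('a, 'm) monoid_scheme \<Rightarrow> ('a list \<Rightarrow> complex) \<Rightarrow> 'a bicochain" where
  "beta G w gs ks = (case (gs, ks) of
      ([g], [x, y]) \<Rightarrow>
        if {g, x, y} \<subseteq> carrier G
        then w [g, x, y] * w [cnj_act G g x, cnj_act G g y, g] / w [cnj_act G g x, g, y]
        else 1
    | _ \<Rightarrow> 1)"

definition theta :: "('a list \<Rightarrow> complex) \<Rightarrow> 'a bicochain" where
  "theta w gs ks = (case (gs, ks) of ([], [x, y, z]) \<Rightarrow> w [x, y, z] | _ \<Rightarrow> 1)"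

definition abt :: "('a, 'm) monoid_scheme \<Rightarrow> ('a list \<Rightarrow> complex) \<Rightarrow> nat \<Rightarrow> 'a bicochain" where
  "abt G w = (\<lambda>p\<in>{..3}.
     if p = 0 then theta w else if p = 1 then beta G w else if p = 2 then alpha G w
     else (\<lambda>gs ks. 1))"

end

theory Submission
  imports Defs
begin

text \<open>
  The shuffle map from the bar complex of the semidirect product to the total complex has the
  Alexander-Whitney map as a right inverse; in the other order the composite is the identity up to
  an explicit homotopy, so on cohomology both maps are isomorphisms. Composed with the pullback
  along \<open>mu\<close>, the shuffle map sends \<open>w\<close> to exactly \<open>alpha\<close>, \<open>beta\<close>, \<open>theta\<close> and \<open>w\<close> itself.
  Hence \<open>w \<mapsto> abt w\<close> comes from a cochain map, and this map splits the projection of the complex of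
  \<open>Apq\<close> onto its column \<open>p = 0\<close>. The kernel of the projection is the complex of \<open>Bpq\<close>, so
  subtracting from a cocycle the lift of its column inverts the last map of the theorem.
\<close>

section \<open>Cohomology in a single degree\<close>

text \<open>The statement concerns degree 3, so the comparison of complexes rests on the
  differentials from degree 2 to 3 and from 3 to 4; these identities are checked by evaluating both
  sides on every kind of simplex. The delicate half of the canonical isomorphism is injectivity: a
  cocycle with trivial shuffle image must bound. On chains, [s] - EZ(AW[s]) - h(boundary of s) is
  itself the boundary of a 4-chain, and a cocycle takes the value 1 on such a boundary. This writes
  \<open>f\<close> as \<open>AW_map\<close> of its shuffle image times the coboundary of
  \<open>ez_homotopy f\<close>. The splitting behind the last map comes from \<mu>(k, 1) = k:
  without letters of the acting group there is a single shuffle, so the lift of \<open>w\<close> has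
  in the column p = 0 the cochain \<open>w\<close> itself, read on K = G.\<close>

lemma (in comm_group) rcos_eq_iff:
  assumes "subgroup B G" "x \<in> carrier G" "y \<in> carrier G"
  shows "B #> x = B #> y \<longleftrightarrow> (\<exists>b\<in>B. x = b \<otimes> y)"
proof
  assume "B #> x = B #> y"
  with assms have "x \<in> B #> y" using rcos_self by metis
  then show "\<exists>b\<in>B. x = b \<otimes> y" by (auto simp: r_coset_def)
next
  assume "\<exists>b\<in>B. x = b \<otimes> y"
  then have "x \<in> B #> y" by (auto simp: r_coset_def)
  then show "B #> x = B #> y" using assms repr_independence by metis
qed

text \<open>
  Instead of \<open>d \<circ> d = 1\<close>, the locale relies on cosets of coboundaries multiplying well inside the
  whole cochain group.
\<close>

locale cochain_degree =
  fixes C :: "nat \<Rightarrow> 'c monoid" and d :: "nat \<Rightarrow> 'c \<Rightarrow> 'c" and n :: nat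
  assumes comm: "comm_group (C n)"
    and cocycles_subgroup: "subgroup (cocycles C d n) (C n)"
    and coboundaries_subgroup: "subgroup (coboundaries C d n) (C n)"
begin

lemma carrier_cohomology: "carrier (cohomology C d n) = coh_class C d n ` cocycles C d n"
  by (auto simp: cohomology_def FactGroup_def RCOSETS_def coh_class_def r_coset_def)

lemma cocyclesD: "x \<in> cocycles C d n \<Longrightarrow> x \<in> carrier (C n)"
  using cocycles_subgroup subgroup.mem_carrier by metis

lemma mult_class:
  assumes "x \<in> carrier (C n)" "y \<in> carrier (C n)"
  shows "coh_class C d n x \<otimes>\<^bsub>cohomology C d n\<^esub> coh_class C d n y
         = coh_class C d n (x \<otimes>\<^bsub>C n\<^esub> y)"
proof -
  interpret comm_group "C n" by (rule comm)
  have "coboundaries C d n \<lhd> C n"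
    using coboundaries_subgroup subgroup_imp_normal by blast
  then show ?thesis
    using normal.rcos_sum[OF _ assms]
    by (simp add: cohomology_def FactGroup_def coh_class_def set_mult_def)
qed

lemma class_eq_iff:
  assumes "x \<in> carrier (C n)" "y \<in> carrier (C n)"
  shows "coh_class C d n x = coh_class C d n y \<longleftrightarrow>
         (\<exists>b\<in>coboundaries C d n. x = b \<otimes>\<^bsub>C n\<^esub> y)"
  unfolding coh_class_def
  using comm_group.rcos_eq_iff[OF comm coboundaries_subgroup] assms by blast

text \<open>Two representatives differ by a coboundary, which \<open>\<phi>\<close> sends to a
  coboundary, so all cosets in the union agree; \<open>x\<close> lies in its own coset, so the union
  is not empty.\<close>

lemma induced_map_class:
  assumes D: "cochain_degree D d' m"
    and hom: "\<phi> \<in> hom (C n) (D m)"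
    and cob: "\<phi> ` coboundaries C d n \<subseteq> coboundaries D d' m"
    and x: "x \<in> carrier (C n)"
  shows "induced_map D d' m \<phi> (coh_class C d n x) = coh_class D d' m (\<phi> x)"
proof -
  have mem: "\<phi> z \<in> carrier (D m)" if "z \<in> carrier (C n)" for z
    using hom that by (auto simp: hom_def)
  have B: "z \<in> carrier (C n)" if "z \<in> coboundaries C d n" for z
    using coboundaries_subgroup subgroup.mem_carrier that by metis
  have "coh_class D d' m (\<phi> y) = coh_class D d' m (\<phi> x)" if "y \<in> coh_class C d n x" for y
  proof -
    obtain b where b: "b \<in> coboundaries C d n" "y = b \<otimes>\<^bsub>C n\<^esub> x"
      using \<open>y \<in> coh_class C d n x\<close> by (auto simp: coh_class_def r_coset_def)
    then have "\<phi> y = \<phi> b \<otimes>\<^bsub>D m\<^esub> \<phi> x" using hom x B by (auto simp: hom_def)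
    moreover have "y \<in> carrier (C n)"
      using b x B comm comm_group.axioms(1) monoid.m_closed comm_monoid.axioms(1) by metis
    ultimately show ?thesis
      using cochain_degree.class_eq_iff[OF D mem mem] x b(1) cob by blast
  qed
  moreover have "x \<in> coh_class C d n x"
    unfolding coh_class_def
    using group.rcos_self[OF comm_group.axioms(2)[OF comm] x coboundaries_subgroup] .
  ultimately show ?thesis unfolding induced_map_def by blast
qed

end

text \<open>The values of \<open>d (Suc m)\<close> come without a carrier, so \<open>r_one\<close>
  supplies the unit law for them. With it the inverse of a cocycle is a cocycle: d(x^-1) = d(x^-1) 1
  = d(x^-1) d(x) = d(1) = 1.\<close>

lemma cochain_degreeI:
  assumes comm: "comm_group (C (Suc m))" "comm_group (C m)"
    and d: "d m \<in> hom (C m) (C (Suc m))"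
    and mult: "\<And>x y. x \<in> carrier (C (Suc m)) \<Longrightarrow> y \<in> carrier (C (Suc m)) \<Longrightarrow>
        d (Suc m) (x \<otimes>\<^bsub>C (Suc m)\<^esub> y) = d (Suc m) x \<otimes>\<^bsub>C (Suc (Suc m))\<^esub> d (Suc m) y"
    and one: "d (Suc m) \<one>\<^bsub>C (Suc m)\<^esub> = \<one>\<^bsub>C (Suc (Suc m))\<^esub>"
    and r_one: "\<And>x. x \<in> carrier (C (Suc m)) \<Longrightarrow>
        d (Suc m) x \<otimes>\<^bsub>C (Suc (Suc m))\<^esub> \<one>\<^bsub>C (Suc (Suc m))\<^esub> = d (Suc m) x"
  shows "cochain_degree C d (Suc m)"
proof (rule cochain_degree.intro)
  interpret M: comm_group "C (Suc m)" by (rule comm)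
  interpret L: comm_group "C m" by (rule comm)
  interpret h: group_hom "C m" "C (Suc m)" "d m"
    using d by (simp add: group_hom_def group_hom_axioms_def L.is_group M.is_group)
  show "comm_group (C (Suc m))" by (rule comm)
  show "subgroup (cocycles C d (Suc m)) (C (Suc m))"
  proof (rule M.subgroupI)
    show "cocycles C d (Suc m) \<noteq> {}" using one by (auto simp: cocycles_def kernel_def)
  next
    fix x assume "x \<in> cocycles C d (Suc m)"
    then have x: "x \<in> carrier (C (Suc m))" "d (Suc m) x = \<one>\<^bsub>C (Suc (Suc m))\<^esub>"
      by (auto simp: cocycles_def kernel_def)
    show "inv\<^bsub>C (Suc m)\<^esub> x \<in> cocycles C d (Suc m)"
      using mult[of "inv\<^bsub>C (Suc m)\<^esub> x" x] r_one[of "inv\<^bsub>C (Suc m)\<^esub> x"] x one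
      by (simp add: cocycles_def kernel_def)
  next
    fix x y assume "x \<in> cocycles C d (Suc m)" "y \<in> cocycles C d (Suc m)"
    then show "x \<otimes>\<^bsub>C (Suc m)\<^esub> y \<in> cocycles C d (Suc m)"
      using mult[of x y] r_one[of x] by (auto simp: cocycles_def kernel_def)
  qed (auto simp: cocycles_def kernel_def)
  show "subgroup (coboundaries C d (Suc m)) (C (Suc m))"
    using h.img_is_subgroup by (simp add: coboundaries_def)
qed

lemma coboundaries_3: "coboundaries C d 3 = d 2 ` carrier (C 2)"
  by (simp add: coboundaries_def numeral_3_eq_3 numeral_2_eq_2)

lemma cocycles_3: "x \<in> cocycles C d 3 \<longleftrightarrow> x \<in> carrier (C 3) \<and> d 3 x = \<one>\<^bsub>C 4\<^esub>"
  by (simp add: cocycles_def kernel_def)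

lemma (in cochain_degree) class_eq_one_iff:
  assumes "x \<in> carrier (C n)"
  shows "coh_class C d n x = coh_class C d n \<one>\<^bsub>C n\<^esub> \<longleftrightarrow> x \<in> coboundaries C d n"
proof -
  interpret comm_group "C n" by (rule comm)
  have "b \<in> carrier (C n)" if "b \<in> coboundaries C d n" for b
    using that coboundaries_subgroup subgroup.mem_carrier by metis
  then show ?thesis using class_eq_iff[OF assms one_closed] by force
qed

text \<open>The kernel is compared with \<open>\<phi> \<one>\<close> because \<open>T\<close> is not known to be a group.\<close>

lemma (in cochain_degree) iso_cohomologyI:
  assumes cls: "\<And>x. x \<in> cocycles C d n \<Longrightarrow> \<Phi> (coh_class C d n x) = \<phi> x"
    and mult: "\<And>x y. x \<in> cocycles C d n \<Longrightarrow> y \<in> cocycles C d n \<Longrightarrow> \<phi> (x \<otimes>\<^bsub>C n\<^esub> y) = \<phi> x \<otimes>\<^bsub>T\<^esub> \<phi> y"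
    and surj: "\<phi> ` cocycles C d n = carrier T"
    and ker: "\<And>x. x \<in> cocycles C d n \<Longrightarrow> \<phi> x = \<phi> \<one>\<^bsub>C n\<^esub> \<Longrightarrow> x \<in> coboundaries C d n"
  shows "\<Phi> \<in> iso (cohomology C d n) T"
proof -
  interpret comm_group "C n" by (rule comm)
  interpret Z: subgroup "cocycles C d n" "C n" by (rule cocycles_subgroup)
  have "inj_on \<Phi> (carrier (cohomology C d n))"
    unfolding carrier_cohomology
  proof (rule inj_onI, clarify)
    fix x y assume x: "x \<in> cocycles C d n" and y: "y \<in> cocycles C d n"
      and eq: "\<Phi> (coh_class C d n x) = \<Phi> (coh_class C d n y)"
    let ?z = "x \<otimes>\<^bsub>C n\<^esub> inv\<^bsub>C n\<^esub> y"
    \<comment> \<open>With no inverses available in \<open>T\<close>, the factor for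
      \<open>x\<close> is replaced by the one for \<open>y\<close> and then recombined with that of
      the inverse of \<open>y\<close>.\<close>
    have "\<phi> ?z = \<phi> y \<otimes>\<^bsub>T\<^esub> \<phi> (inv\<^bsub>C n\<^esub> y)"
      using x y eq cls mult by simp
    also have "\<dots> = \<phi> \<one>\<^bsub>C n\<^esub>"
      using y mult[of y "inv\<^bsub>C n\<^esub> y"] by simp
    finally have "?z \<in> coboundaries C d n"
      using ker x y by simp
    moreover have "x = ?z \<otimes>\<^bsub>C n\<^esub> y"
      using x y by (simp add: m_assoc)
    ultimately show "coh_class C d n x = coh_class C d n y"
      using class_eq_iff x y by auto
  qed
  moreover have "\<Phi> ` carrier (cohomology C d n) = carrier T"
    using surj cls by (force simp: carrier_cohomology image_image)
  ultimately show ?thesis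
    using cls mult by (auto simp: iso_def hom_def bij_betw_def carrier_cohomology mult_class)
qed

lemma iso_cohomology_pairI:
  assumes "cochain_degree C d n" "cochain_degree D e m"
    and cls: "\<And>x y. x \<in> cocycles C d n \<Longrightarrow> y \<in> cocycles D e m \<Longrightarrow>
        \<Phi> (coh_class C d n x, coh_class D e m y) = \<phi> x y"
    and mult: "\<And>x y x' y'. x \<in> cocycles C d n \<Longrightarrow> y \<in> cocycles D e m \<Longrightarrow>
        x' \<in> cocycles C d n \<Longrightarrow> y' \<in> cocycles D e m \<Longrightarrow>
        \<phi> (x \<otimes>\<^bsub>C n\<^esub> x') (y \<otimes>\<^bsub>D m\<^esub> y') = \<phi> x y \<otimes>\<^bsub>T\<^esub> \<phi> x' y'"
    and surj: "(\<lambda>(x, y). \<phi> x y) ` (cocycles C d n \<times> cocycles D e m) = carrier T"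
    and ker: "\<And>x y. x \<in> cocycles C d n \<Longrightarrow> y \<in> cocycles D e m \<Longrightarrow>
        \<phi> x y = \<phi> \<one>\<^bsub>C n\<^esub> \<one>\<^bsub>D m\<^esub> \<Longrightarrow> x \<in> coboundaries C d n \<and> y \<in> coboundaries D e m"
  shows "\<Phi> \<in> iso (cohomology C d n \<times>\<times> cohomology D e m) T"
proof -
  interpret C: cochain_degree C d n by fact
  interpret D: cochain_degree D e m by fact
  interpret c: comm_group "C n" by (rule C.comm)
  interpret d: comm_group "D m" by (rule D.comm)
  interpret ZC: subgroup "cocycles C d n" "C n" by (rule C.cocycles_subgroup)
  interpret ZD: subgroup "cocycles D e m" "D m" by (rule D.cocycles_subgroup)
  have "inj_on \<Phi> (carrier (cohomology C d n \<times>\<times> cohomology D e m))"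
  proof (rule inj_onI)
    fix u v assume "u \<in> carrier (cohomology C d n \<times>\<times> cohomology D e m)"
      and "v \<in> carrier (cohomology C d n \<times>\<times> cohomology D e m)" and eq: "\<Phi> u = \<Phi> v"
    then obtain x y x' y' where u: "u = (coh_class C d n x, coh_class D e m y)"
      and v: "v = (coh_class C d n x', coh_class D e m y')"
      and xy: "x \<in> cocycles C d n" "y \<in> cocycles D e m" "x' \<in> cocycles C d n" "y' \<in> cocycles D e m"
      by (auto simp: C.carrier_cohomology D.carrier_cohomology)
    let ?z = "x \<otimes>\<^bsub>C n\<^esub> inv\<^bsub>C n\<^esub> x'" and ?t = "y \<otimes>\<^bsub>D m\<^esub> inv\<^bsub>D m\<^esub> y'"
    have "\<phi> ?z ?t = \<phi> x' y' \<otimes>\<^bsub>T\<^esub> \<phi> (inv\<^bsub>C n\<^esub> x') (inv\<^bsub>D m\<^esub> y')"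
      using xy eq cls mult by (simp add: u v)
    also have "\<dots> = \<phi> \<one>\<^bsub>C n\<^esub> \<one>\<^bsub>D m\<^esub>"
      using xy mult[of x' y' "inv\<^bsub>C n\<^esub> x'" "inv\<^bsub>D m\<^esub> y'"] by simp
    finally have "?z \<in> coboundaries C d n \<and> ?t \<in> coboundaries D e m"
      by (intro ker) (use xy in simp_all)
    moreover have "x = ?z \<otimes>\<^bsub>C n\<^esub> x'" "y = ?t \<otimes>\<^bsub>D m\<^esub> y'"
      using xy by (simp_all add: c.m_assoc d.m_assoc)
    ultimately show "u = v"
      using C.class_eq_iff D.class_eq_iff xy by (auto simp: u v)
  qed
  moreover have carrier: "carrier (cohomology C d n \<times>\<times> cohomology D e m) =
      (\<lambda>(x, y). (coh_class C d n x, coh_class D e m y)) ` (cocycles C d n \<times> cocycles D e m)"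
    by (auto simp: C.carrier_cohomology D.carrier_cohomology)
  moreover have "\<Phi> ` carrier (cohomology C d n \<times>\<times> cohomology D e m) = carrier T"
    unfolding carrier image_image surj[symmetric] by (rule image_cong) (auto simp: cls)
  moreover have "\<Phi> \<in> hom (cohomology C d n \<times>\<times> cohomology D e m) T"
  proof (rule homI)
    fix u assume "u \<in> carrier (cohomology C d n \<times>\<times> cohomology D e m)"
    then show "\<Phi> u \<in> carrier T"
      unfolding carrier surj[symmetric] by (force simp: cls)
  next
    fix u v assume "u \<in> carrier (cohomology C d n \<times>\<times> cohomology D e m)"
      "v \<in> carrier (cohomology C d n \<times>\<times> cohomology D e m)"
    then show "\<Phi> (u \<otimes>\<^bsub>cohomology C d n \<times>\<times> cohomology D e m\<^esub> v) = \<Phi> u \<otimes>\<^bsub>T\<^esub> \<Phi> v"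
      unfolding carrier by (auto simp: C.mult_class D.mult_class cls mult)
  qed
  ultimately show ?thesis by (simp add: iso_def bij_betw_def)
qed

lemma coboundaries_image:
  assumes "\<And>x. x \<in> carrier (C 2) \<Longrightarrow> \<psi> x \<in> carrier (D 2)"
    and "\<And>x. x \<in> carrier (C 2) \<Longrightarrow> \<phi> (d 2 x) = e 2 (\<psi> x)"
  shows "\<phi> ` coboundaries C d 3 \<subseteq> coboundaries D e 3"
  using assms by (auto simp: coboundaries_3)

lemma induced_map_class_3:
  assumes "cochain_degree C d 3" "cochain_degree D e 3" "\<And>n. \<phi> n \<in> hom (C n) (D n)"
    and "\<And>x. x \<in> carrier (C 2) \<Longrightarrow> \<phi> 3 (d 2 x) = e 2 (\<phi> 2 x)"
    and "x \<in> carrier (C 3)"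
  shows "induced_map D e 3 (\<phi> 3) (coh_class C d 3 x) = coh_class D e 3 (\<phi> 3 x)"
proof (rule cochain_degree.induced_map_class[OF assms(1,2,3) _ assms(5)])
  show "\<phi> 3 ` coboundaries C d 3 \<subseteq> coboundaries D e 3"
    using assms(3)[of 2] assms(4) by (intro coboundaries_image[where \<psi> = "\<phi> 2"]) (auto simp: hom_def)
qed

section \<open>Groups of circle-valued cochains\<close>

lemma inv_bar:
  assumes "f \<in> carrier (bar G n)"
  shows "(\<lambda>gs. inverse (f gs)) \<in> carrier (bar G n)"
  using assms by (auto simp: bar_def norm_inverse)

lemma comm_group_bar: "comm_group (bar G n)"
proof (rule comm_groupI)
  fix f assume f: "f \<in> carrier (bar G n)"
  have nz: "f gs \<noteq> 0" for gs using f by (auto simp: bar_def) (metis norm_zero zero_neq_one)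
  show "\<exists>h\<in>carrier (bar G n). h \<otimes>\<^bsub>bar G n\<^esub> f = \<one>\<^bsub>bar G n\<^esub>"
    by (rule bexI[OF _ inv_bar[OF f]]) (use nz in \<open>auto simp: bar_def\<close>)
qed (auto simp: bar_def norm_mult fun_eq_iff)

lemma inv_Cpq:
  assumes "F \<in> carrier (Cpq G p q)"
  shows "(\<lambda>gs ks. inverse (F gs ks)) \<in> carrier (Cpq G p q)"
  using assms by (auto simp: Cpq_def norm_inverse)

lemma comm_group_Cpq: "comm_group (Cpq G p q)"
proof (rule comm_groupI)
  fix F assume F: "F \<in> carrier (Cpq G p q)"
  have nz: "F gs ks \<noteq> 0" for gs ks
    using F by (auto simp: Cpq_def) (metis norm_zero zero_neq_one)
  show "\<exists>h\<in>carrier (Cpq G p q). h \<otimes>\<^bsub>Cpq G p q\<^esub> F = \<one>\<^bsub>Cpq G p q\<^esub>"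
    by (rule bexI[OF _ inv_Cpq[OF F]]) (use nz in \<open>auto simp: Cpq_def\<close>)
qed (auto simp: Cpq_def norm_mult fun_eq_iff)

section \<open>Differentials in low degrees\<close>

lemma bar_nonzero: "f \<in> carrier (bar G n) \<Longrightarrow> f gs \<noteq> 0"
  by (auto simp: bar_def) (metis norm_zero zero_neq_one)

lemma bar_normalized: "f \<in> carrier (bar G n) \<Longrightarrow> \<one>\<^bsub>G\<^esub> \<in> set gs \<Longrightarrow> f gs = 1"
  by (auto simp: bar_def)

lemma Cpq_nonzero: "F \<in> carrier (Cpq G p q) \<Longrightarrow> F gs ks \<noteq> 0"
  by (auto simp: Cpq_def) (metis norm_zero zero_neq_one)

lemma Cpq_normalized:
  "F \<in> carrier (Cpq G p q) \<Longrightarrow> \<one>\<^bsub>G\<^esub> \<in> set gs \<or> \<one>\<^bsub>G\<^esub> \<in> set ks \<Longrightarrow> F gs ks = 1"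
  by (auto simp: Cpq_def)

text \<open>Both spellings of the lower bound occur, since the simplifier turns 1 into
  \<open>Suc 0\<close>.\<close>

lemma Icc_numeral: "{1..0::nat} = {}" "{1..1::nat} = {1}" "{1..2::nat} = {1, 2}" "{1..3::nat} = {1, 2, 3}"
  "{Suc 0..0} = {}" "{Suc 0..2} = {1, 2}" "{Suc 0..3} = {1, 2, 3}"
  by auto

lemmas d_simps = Icc_numeral merge_def power_int_minus power_numeral_reduce

lemma bar_d_2:
  "{x, y, z} \<subseteq> carrier G \<Longrightarrow> bar_d G 2 f [x, y, z] =
     f [y, z] * inverse (f [x \<otimes>\<^bsub>G\<^esub> y, z]) * f [x, y \<otimes>\<^bsub>G\<^esub> z] * inverse (f [x, y])"
  by (simp add: bar_d_def d_simps)

lemma bar_d_3: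
  "{x, y, z, t} \<subseteq> carrier G \<Longrightarrow> bar_d G 3 f [x, y, z, t] =
     f [y, z, t] * inverse (f [x \<otimes>\<^bsub>G\<^esub> y, z, t]) * f [x, y \<otimes>\<^bsub>G\<^esub> z, t]
       * inverse (f [x, y, z \<otimes>\<^bsub>G\<^esub> t]) * f [x, y, z]"
  by (simp add: bar_d_def d_simps)

lemma delta_G_0:
  "{x} \<subseteq> carrier G \<Longrightarrow> length ks = q \<Longrightarrow> set ks \<subseteq> carrier G \<Longrightarrow> delta_G G 0 q F [x] ks =
     F [] ks * inverse (F [] (map (cnj_act G x) ks))"
  by (simp add: delta_G_def d_simps)

lemma delta_G_1:
  "{x, y} \<subseteq> carrier G \<Longrightarrow> length ks = q \<Longrightarrow> set ks \<subseteq> carrier G \<Longrightarrow> delta_G G 1 q F [x, y] ks =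
     F [y] ks * inverse (F [x \<otimes>\<^bsub>G\<^esub> y] ks) * F [x] (map (cnj_act G y) ks)"
  by (simp add: delta_G_def d_simps)

lemma delta_G_2:
  "{x, y, z} \<subseteq> carrier G \<Longrightarrow> length ks = q \<Longrightarrow> set ks \<subseteq> carrier G \<Longrightarrow> delta_G G 2 q F [x, y, z] ks =
     F [y, z] ks * inverse (F [x \<otimes>\<^bsub>G\<^esub> y, z] ks) * F [x, y \<otimes>\<^bsub>G\<^esub> z] ks
       * inverse (F [x, y] (map (cnj_act G z) ks))"
  by (simp add: delta_G_def d_simps)

lemma delta_G_3:
  "{x, y, z, t} \<subseteq> carrier G \<Longrightarrow> length ks = q \<Longrightarrow> set ks \<subseteq> carrier G \<Longrightarrow> delta_G G 3 q F [x, y, z, t] ks =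
     F [y, z, t] ks * inverse (F [x \<otimes>\<^bsub>G\<^esub> y, z, t] ks) * F [x, y \<otimes>\<^bsub>G\<^esub> z, t] ks
       * inverse (F [x, y, z \<otimes>\<^bsub>G\<^esub> t] ks) * F [x, y, z] (map (cnj_act G t) ks)"
  by (simp add: delta_G_def d_simps)

text \<open>For q = 0 the two outer faces coincide. Hence the value is 1 wherever \<open>F\<close>
  is nonzero, which is why the row q = 0 splits off.\<close>

lemma delta_K_0:
  "{k} \<subseteq> carrier G \<Longrightarrow> length gs = p \<Longrightarrow> set gs \<subseteq> carrier G \<Longrightarrow> delta_K G p 0 F gs [k] =
     F gs [] * inverse (F gs [])"
  by (simp add: delta_K_def d_simps)

lemma delta_K_1:
  "{k, l} \<subseteq> carrier G \<Longrightarrow> length gs = p \<Longrightarrow> set gs \<subseteq> carrier G \<Longrightarrow> delta_K G p 1 F gs [k, l] =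
     F gs [l] * inverse (F gs [k \<otimes>\<^bsub>G\<^esub> l]) * F gs [k]"
  by (simp add: delta_K_def d_simps)

lemma delta_K_2:
  "{k, l, m} \<subseteq> carrier G \<Longrightarrow> length gs = p \<Longrightarrow> set gs \<subseteq> carrier G \<Longrightarrow> delta_K G p 2 F gs [k, l, m] =
     F gs [l, m] * inverse (F gs [k \<otimes>\<^bsub>G\<^esub> l, m]) * F gs [k, l \<otimes>\<^bsub>G\<^esub> m] * inverse (F gs [k, l])"
  by (simp add: delta_K_def d_simps)

lemma delta_K_3:
  "{k, l, m, n} \<subseteq> carrier G \<Longrightarrow> length gs = p \<Longrightarrow> set gs \<subseteq> carrier G \<Longrightarrow> delta_K G p 3 F gs [k, l, m, n] =
     F gs [l, m, n] * inverse (F gs [k \<otimes>\<^bsub>G\<^esub> l, m, n]) * F gs [k, l \<otimes>\<^bsub>G\<^esub> m, n]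
       * inverse (F gs [k, l, m \<otimes>\<^bsub>G\<^esub> n]) * F gs [k, l, m]"
  by (simp add: delta_K_def d_simps)

section \<open>Computing in the semidirect product\<close>

lemma semidirect_simps:
  "carrier (semidirect G) = carrier G \<times> carrier G"
  "(a, g) \<otimes>\<^bsub>semidirect G\<^esub> (b, h) = (a \<otimes>\<^bsub>G\<^esub> cnj_act G g b, g \<otimes>\<^bsub>G\<^esub> h)"
  "\<one>\<^bsub>semidirect G\<^esub> = (\<one>\<^bsub>G\<^esub>, \<one>\<^bsub>G\<^esub>)"
  by (simp_all add: semidirect_def)

lemma (in group) cnj_act_one: "k \<in> carrier G \<Longrightarrow> cnj_act G \<one> k = k"
  by (simp add: cnj_act_def)

text \<open>Rewrite rules towards a normal form: conjugation is pushed down to single letters, and g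
  k g^-1 g collapses to g k. The last rule is the previous one in right-associated form, so that
  both work together with \<open>m_assoc\<close>.\<close>

lemma (in group) cnj_act:
  assumes "g \<in> carrier G"
  shows "k \<in> carrier G \<Longrightarrow> cnj_act G g k \<in> carrier G"
    "cnj_act G g \<one> = \<one>"
    "k \<in> carrier G \<Longrightarrow> l \<in> carrier G \<Longrightarrow> cnj_act G g (k \<otimes> l) = cnj_act G g k \<otimes> cnj_act G g l"
    "h \<in> carrier G \<Longrightarrow> k \<in> carrier G \<Longrightarrow> cnj_act G (g \<otimes> h) k = cnj_act G g (cnj_act G h k)"
    "k \<in> carrier G \<Longrightarrow> cnj_act G g k \<otimes> g = g \<otimes> k"
    "k \<in> carrier G \<Longrightarrow> l \<in> carrier G \<Longrightarrow> cnj_act G g k \<otimes> (g \<otimes> l) = g \<otimes> (k \<otimes> l)"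
  using assms by (simp_all add: cnj_act_def m_assoc inv_mult_group inv_solve_left flip: m_assoc)
    (simp_all add: m_assoc inv_solve_left)

lemmas (in group) cnj_act_simps = cnj_act_one cnj_act

lemma length_numeral_conv:
  "length xs = 1 \<longleftrightarrow> (\<exists>x. xs = [x])"
  "length xs = 2 \<longleftrightarrow> (\<exists>x y. xs = [x, y])"
  "length xs = 3 \<longleftrightarrow> (\<exists>x y z. xs = [x, y, z])"
  "length xs = 4 \<longleftrightarrow> (\<exists>x y z t. xs = [x, y, z, t])"
  by (auto simp: numeral_eq_Suc length_Suc_conv)

lemmas d_eval =
  bar_d_2 bar_d_3 delta_G_0 delta_G_1 delta_G_2 delta_G_3 delta_K_0 delta_K_1 delta_K_2 delta_K_3
  delta_G_1[unfolded One_nat_def] delta_K_1[unfolded One_nat_def]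

section \<open>Total cochains determined by their values on simplices\<close>

definition supported :: "('a, 'm) monoid_scheme \<Rightarrow> nat \<Rightarrow> (nat \<Rightarrow> 'a bicochain) \<Rightarrow> bool" where
  "supported G n F \<longleftrightarrow> F \<in> extensional {..n} \<and>
     (\<forall>p\<le>n. \<forall>gs ks. \<not> (length gs = p \<and> length ks = n - p \<and> set gs \<subseteq> carrier G \<and> set ks \<subseteq> carrier G)
        \<longrightarrow> F p gs ks = 1)"

lemma supported_eqI:
  assumes "supported G n F" "supported G n F'"
    and "\<And>p gs ks. p \<le> n \<Longrightarrow> length gs = p \<Longrightarrow> length ks = n - p \<Longrightarrow> set gs \<subseteq> carrier G \<Longrightarrow>
           set ks \<subseteq> carrier G \<Longrightarrow> F p gs ks = F' p gs ks"
  shows "F = F'"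
proof (rule extensionalityI[of _ "{..n}"])
  fix p assume "p \<in> {..n}"
  then show "F p = F' p" using assms unfolding supported_def atMost_iff
    by (intro ext) metis
qed (use assms in \<open>auto simp: supported_def\<close>)

text \<open>Holds for arbitrary \<open>F\<close>, because \<open>supported\<close> speaks of default
  values only and leaves out modulus and normalization. Equalities with a differential can thus be
  tested on simplices before its closure is known.\<close>

lemma supported_Tot_d: "supported G (Suc n) (Tot_d G n F)"
proof -
  have "Tot_d G n F p gs ks = 1"
    if p: "p \<le> Suc n"
      and out: "\<not> (length gs = p \<and> length ks = Suc n - p \<and> set gs \<subseteq> carrier G \<and> set ks \<subseteq> carrier G)"
    for p gs ks
  proof -
    have "delta_G G (p - 1) (n + 1 - p) (F (p - 1)) gs ks = 1" if "p > 0"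
      using p out that unfolding delta_G_def by auto
    moreover have "delta_K G p (n - p) (F p) gs ks = 1" if "p \<le> n"
      using p out that unfolding delta_K_def by (auto simp: Suc_diff_le)
    ultimately show ?thesis using p unfolding Tot_d_def by auto
  qed
  then show ?thesis by (auto simp: supported_def Tot_d_def)
qed

lemma supported_shuffle_map: "supported G n (shuffle_map G n f)"
  by (auto simp: supported_def shuffle_map_def)

lemma supported_Tot: "F \<in> carrier (Tot (Cpq G) n) \<Longrightarrow> supported G n F"
  by (auto simp: supported_def Tot_def Cpq_def PiE_iff)

lemma supported_3_eqI:
  assumes "supported G 3 F" "supported G 3 F'"
    and "\<And>x y z. {x, y, z} \<subseteq> carrier G \<Longrightarrow> F 0 [] [x, y, z] = F' 0 [] [x, y, z]"
    and "\<And>x y z. {x, y, z} \<subseteq> carrier G \<Longrightarrow> F 1 [x] [y, z] = F' 1 [x] [y, z]"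
    and "\<And>x y z. {x, y, z} \<subseteq> carrier G \<Longrightarrow> F 2 [x, y] [z] = F' 2 [x, y] [z]"
    and "\<And>x y z. {x, y, z} \<subseteq> carrier G \<Longrightarrow> F 3 [x, y, z] [] = F' 3 [x, y, z] []"
  shows "F = F'"
proof (rule supported_eqI[OF assms(1,2)])
  fix p and gs ks :: "'a list"
  assume *: "p \<le> 3" "length gs = p" "length ks = 3 - p" "set gs \<subseteq> carrier G" "set ks \<subseteq> carrier G"
  then have "p = 0 \<or> p = 1 \<or> p = 2 \<or> p = 3" by linarith
  with * consider "p = 0" "length gs = 0" "length ks = 3" | "p = 1" "length gs = 1" "length ks = 2"
    | "p = 2" "length gs = 2" "length ks = 1" | "p = 3" "length gs = 3" "length ks = 0"
    by fastforce
  then show "F p gs ks = F' p gs ks"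
    using assms(3-6) *(4,5) unfolding length_numeral_conv by cases auto
qed

lemma supported_4_eqI:
  assumes "supported G 4 F" "supported G 4 F'"
    and "\<And>x y z t. {x, y, z, t} \<subseteq> carrier G \<Longrightarrow> F 0 [] [x, y, z, t] = F' 0 [] [x, y, z, t]"
    and "\<And>x y z t. {x, y, z, t} \<subseteq> carrier G \<Longrightarrow> F 1 [x] [y, z, t] = F' 1 [x] [y, z, t]"
    and "\<And>x y z t. {x, y, z, t} \<subseteq> carrier G \<Longrightarrow> F 2 [x, y] [z, t] = F' 2 [x, y] [z, t]"
    and "\<And>x y z t. {x, y, z, t} \<subseteq> carrier G \<Longrightarrow> F 3 [x, y, z] [t] = F' 3 [x, y, z] [t]"
    and "\<And>x y z t. {x, y, z, t} \<subseteq> carrier G \<Longrightarrow> F 4 [x, y, z, t] [] = F' 4 [x, y, z, t] []"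
  shows "F = F'"
proof (rule supported_eqI[OF assms(1,2)])
  fix p and gs ks :: "'a list"
  assume *: "p \<le> 4" "length gs = p" "length ks = 4 - p" "set gs \<subseteq> carrier G" "set ks \<subseteq> carrier G"
  then have "p = 0 \<or> p = 1 \<or> p = 2 \<or> p = 3 \<or> p = 4" by linarith
  with * consider "p = 0" "length gs = 0" "length ks = 4" | "p = 1" "length gs = 1" "length ks = 3"
    | "p = 2" "length gs = 2" "length ks = 2" | "p = 3" "length gs = 3" "length ks = 1"
    | "p = 4" "length gs = 4" "length ks = 0"
    by fastforce
  then show "F p gs ks = F' p gs ks"
    using assms(3-7) *(4,5) unfolding length_numeral_conv by cases auto
qed

section \<open>The shuffle map as a cochain map\<close>

context group
begin

lemma group_semidirect: "group (semidirect G)"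
proof (rule groupI)
  fix x assume "x \<in> carrier (semidirect G)"
  then obtain a g where x: "x = (a, g)" "a \<in> carrier G" "g \<in> carrier G"
    by (auto simp: semidirect_simps)
  have "(cnj_act G (inv g) (inv a), inv g) \<otimes>\<^bsub>semidirect G\<^esub> x = \<one>\<^bsub>semidirect G\<^esub>"
    using x by (simp add: semidirect_simps flip: cnj_act(3)) (simp add: cnj_act_simps)
  then show "\<exists>y\<in>carrier (semidirect G). y \<otimes>\<^bsub>semidirect G\<^esub> x = \<one>\<^bsub>semidirect G\<^esub>"
    using x by (intro bexI[of _ "(cnj_act G (inv g) (inv a), inv g)"]) (auto simp: semidirect_simps cnj_act_simps)
qed (auto simp: semidirect_simps cnj_act_simps m_assoc)

text \<open>Two shuffles that differ by swapping adjacent letters have opposite signs and a common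
  inner face, since (1, g)(k, 1) = (g(k), 1)(1, g); these faces cancel. The remaining faces are
  those of \<open>delta_G\<close> and \<open>delta_K\<close>. Dropping a final (1, g) leaves all
  \<open>K\<close>-letters acted on by g, which is the twisted last face of
  \<open>delta_G\<close>.\<close>

lemma shuffle_map_bar_d_2:
  assumes f: "f \<in> carrier (bar (semidirect G) 2)"
  shows "shuffle_map G 3 (bar_d (semidirect G) 2 f) = Tot_d G 2 (shuffle_map G 2 f)"
proof (rule supported_3_eqI)
  show "supported G 3 (Tot_d G 2 (shuffle_map G 2 f))"
    using supported_Tot_d[of G 2] by simp
qed (rule supported_shuffle_map,
  (clarsimp simp: Tot_d_def shuffle_map_def semidirect_simps cnj_act_simps d_eval m_assoc
      power_int_minus bar_nonzero[OF f];
   simp add: divide_simps bar_nonzero[OF f] flip: divide_inverse)+)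

lemma shuffle_map_bar_d_3:
  assumes f: "f \<in> carrier (bar (semidirect G) 3)"
  shows "shuffle_map G 4 (bar_d (semidirect G) 3 f) = Tot_d G 3 (shuffle_map G 3 f)"
proof (rule supported_4_eqI)
  show "supported G 4 (Tot_d G 3 (shuffle_map G 3 f))"
    using supported_Tot_d[of G 3] by simp
qed (rule supported_shuffle_map,
  (clarsimp simp: Tot_d_def shuffle_map_def semidirect_simps cnj_act_simps d_eval m_assoc
      power_int_minus bar_nonzero[OF f];
   simp add: divide_simps bar_nonzero[OF f] flip: divide_inverse)+)

end

section \<open>The shuffle map and the Alexander-Whitney map\<close>

text \<open>
  \<open>back_face\<close> lists the \<open>K\<close>-entries seen from the first vertex: the product of \<open>(a\<^sub>1, g\<^sub>1), \<dots>, (a\<^sub>q, g\<^sub>q)\<close>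
  has first component \<open>a\<^sub>1 \<cdot> g\<^sub>1(a\<^sub>2) \<cdot> (g\<^sub>1 g\<^sub>2)(a\<^sub>3) \<cdots>\<close>.
\<close>

primrec back_face :: "('a, 'm) monoid_scheme \<Rightarrow> ('a \<times> 'a) list \<Rightarrow> 'a list" where
  "back_face G [] = []"
| "back_face G (s # ss) = fst s # map (cnj_act G (snd s)) (back_face G ss)"

text \<open>In bisimplicial coordinates k_j = (g_j ... g_n)^-1 (a_j). Taking the front p-face in the
  direction of the acting group lets g_(p+1) ... g_n act on every k_j, and the back face in the
  other direction keeps j > p. This leaves the entries (g_(p+1) ... g_(j-1))(a_j), which is
  \<open>back_face\<close> of the tail.\<close>

definition AW_map ::
    "('a, 'm) monoid_scheme \<Rightarrow> nat \<Rightarrow> (nat \<Rightarrow> 'a bicochain) \<Rightarrow> ('a \<times> 'a) list \<Rightarrow> complex" where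
  "AW_map G n F ss =
     (if length ss = n \<and> set ss \<subseteq> carrier (semidirect G)
      then \<Prod>p\<le>n. F p (map snd (take p ss)) (back_face G (drop p ss)) else 1)"

lemma Tot_CpqD:
  assumes "F \<in> carrier (Tot (Cpq G) n)" "p \<le> n"
  shows "F p \<in> carrier (Cpq G p (n - p))"
  using assms by (auto simp: Tot_def)

lemma Tot_nonzero: "F \<in> carrier (Tot (Cpq G) n) \<Longrightarrow> p \<le> n \<Longrightarrow> F p gs ks \<noteq> 0"
  using Tot_CpqD Cpq_nonzero by metis

lemma Tot_normalized:
  "F \<in> carrier (Tot (Cpq G) n) \<Longrightarrow> p \<le> n \<Longrightarrow> \<one>\<^bsub>G\<^esub> \<in> set gs \<or> \<one>\<^bsub>G\<^esub> \<in> set ks \<Longrightarrow> F p gs ks = 1"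
  using Tot_CpqD Cpq_normalized by metis

lemma shuffle_prod_one: "shuffle_prod G (\<lambda>v. 1) gs ks = 1"
  by (induction G "\<lambda>v :: ('a \<times> 'a) list. 1 :: complex" gs ks rule: shuffle_prod.induct) simp_all

lemma atMost_numeral: "{..2::nat} = {0, 1, 2}" "{..3::nat} = {0, 1, 2, 3}" "{..4::nat} = {0, 1, 2, 3, 4}"
  by auto

context group
begin

lemma one_in_back_face:
  "\<one>\<^bsub>semidirect G\<^esub> \<in> set ss \<Longrightarrow> set ss \<subseteq> carrier (semidirect G) \<Longrightarrow> \<one> \<in> set (back_face G ss)"
proof (induction ss)
  case (Cons s ss)
  then have "cnj_act G (snd s) \<one> = \<one>" by (auto simp: semidirect_simps cnj_act_simps)
  with Cons show ?case by (force simp: semidirect_simps)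
qed simp

lemma AW_map_closed:
  assumes F: "F \<in> carrier (Tot (Cpq G) n)"
  shows "AW_map G n F \<in> carrier (bar (semidirect G) n)"
proof -
  have "cmod (F p gs ks) = 1" if "p \<le> n" for p gs ks
    using Tot_CpqD[OF F that] by (simp add: Cpq_def)
  then have "cmod (AW_map G n F ss) = 1" for ss
    by (simp add: AW_map_def flip: prod_norm)
  moreover have "AW_map G n F ss = 1" if "\<one>\<^bsub>semidirect G\<^esub> \<in> set ss" for ss
  proof (cases "set ss \<subseteq> carrier (semidirect G)")
    case True
    have "F p (map snd (take p ss)) (back_face G (drop p ss)) = 1" if p: "p \<le> n" for p
    proof (rule Tot_normalized[OF F p])
      have "\<one>\<^bsub>semidirect G\<^esub> \<in> set (take p ss) \<or> \<one>\<^bsub>semidirect G\<^esub> \<in> set (drop p ss)"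
        using \<open>_ \<in> set ss\<close> by (metis Un_iff append_take_drop_id set_append)
      then show "\<one> \<in> set (map snd (take p ss)) \<or> \<one> \<in> set (back_face G (drop p ss))"
        using one_in_back_face[of "drop p ss"] True set_drop_subset[of p ss]
        by (force simp: semidirect_simps image_iff)
    qed
    then show ?thesis by (simp add: AW_map_def)
  qed (simp add: AW_map_def)
  ultimately show ?thesis by (auto simp: bar_def AW_map_def)
qed

text \<open>The last face of \<open>delta_G\<close> at the cut p and the first face of
  \<open>delta_K\<close> at the cut p - 1 both evaluate \<open>F (p - 1)\<close> on g_1, ...,
  g_(p-1) and the tail acted on by g_p. The sign (-1)^p in \<open>Tot_d\<close> makes them cancel;
  the other faces make up the bar differential.\<close>

lemma AW_map_Tot_d_2:
  assumes F: "F \<in> carrier (Tot (Cpq G) 2)"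
  shows "AW_map G 3 (Tot_d G 2 F) = bar_d (semidirect G) 2 (AW_map G 2 F)"
proof
  fix ss
  show "AW_map G 3 (Tot_d G 2 F) ss = bar_d (semidirect G) 2 (AW_map G 2 F) ss"
  proof (cases "length ss = 3 \<and> set ss \<subseteq> carrier (semidirect G)")
    case True
    then show ?thesis unfolding length_numeral_conv
      by (clarsimp simp: AW_map_def Tot_d_def atMost_numeral semidirect_simps cnj_act_simps d_eval m_assoc
          power_int_minus Tot_nonzero[OF F]; simp add: divide_simps Tot_nonzero[OF F] flip: divide_inverse)
  qed (auto simp: AW_map_def bar_d_def)
qed

lemma AW_map_Tot_d_3:
  assumes F: "F \<in> carrier (Tot (Cpq G) 3)"
  shows "AW_map G 4 (Tot_d G 3 F) = bar_d (semidirect G) 3 (AW_map G 3 F)"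
proof
  fix ss
  show "AW_map G 4 (Tot_d G 3 F) ss = bar_d (semidirect G) 3 (AW_map G 3 F) ss"
  proof (cases "length ss = 4 \<and> set ss \<subseteq> carrier (semidirect G)")
    case True
    then show ?thesis unfolding length_numeral_conv
      by (clarsimp simp: AW_map_def Tot_d_def atMost_numeral semidirect_simps cnj_act_simps d_eval m_assoc
          power_int_minus Tot_nonzero[OF F]; simp add: divide_simps Tot_nonzero[OF F] flip: divide_inverse)
  qed (auto simp: AW_map_def bar_d_def)
qed

text \<open>A letter (k, 1) before the cut gives a unit among the \<open>G\<close>-entries, a letter
  (1, g) after it a unit among the \<open>K\<close>-entries. By normalization only the word with all
  g's first, cut after them, contributes; its sign is +1 and none of its k's is acted on.\<close>

lemma shuffle_map_AW_map_3:
  assumes F: "F \<in> carrier (Tot (Cpq G) 3)"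
  shows "shuffle_map G 3 (AW_map G 3 F) = F"
  by (rule supported_3_eqI[OF supported_shuffle_map supported_Tot[OF F]])
    (simp_all add: shuffle_map_def AW_map_def atMost_numeral semidirect_simps cnj_act_simps
      Tot_normalized[OF F] power_int_minus)

text \<open>Conjugation fixes the unit, so a unit among the entries gives a unit letter in every
  shuffle. The two nested inductions follow the two branches of \<open>shuffle_prod\<close>.\<close>

lemma shuffle_prod_normalized:
  assumes "\<And>v. \<one>\<^bsub>semidirect G\<^esub> \<in> set v \<Longrightarrow> f v = 1"
    "set gs \<subseteq> carrier G" "set ks \<subseteq> carrier G" "\<one> \<in> set gs \<or> \<one> \<in> set ks"
  shows "shuffle_prod G f gs ks = 1"
  using assms
proof (induction gs arbitrary: f ks)
  case (Cons g gs)
  note IH = Cons.IH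
  show ?case
    using Cons.prems
  proof (induction ks arbitrary: f)
    case (Cons k ks)
    define x where "x = (cnj_act G (foldr (\<otimes>) (g # gs) \<one>) k, \<one>)"
    have "foldr (\<otimes>) gs \<one> \<in> carrier G"
      using Cons.prems(2) by (induction gs) auto
    then have x: "x = \<one>\<^bsub>semidirect G\<^esub>" if "k = \<one>"
      using Cons.prems(2) that by (simp add: x_def semidirect_simps cnj_act_simps)
    have "shuffle_prod G (\<lambda>v. f ((\<one>, g) # v)) gs (k # ks) = 1"
    proof (cases "g = \<one>")
      case True
      then have "(\<lambda>v. f ((\<one>, g) # v)) = (\<lambda>v. 1)"
        using Cons.prems(1) by (auto simp: semidirect_simps)
      then show ?thesis by (simp add: shuffle_prod_one)
    qed (rule IH, use Cons.prems in auto)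
    moreover have "shuffle_prod G (\<lambda>v. f (x # v)) (g # gs) ks = 1"
    proof (cases "k = \<one>")
      case True
      then have "(\<lambda>v. f (x # v)) = (\<lambda>v. 1)"
        using Cons.prems(1) x by auto
      then show ?thesis by (simp add: shuffle_prod_one)
    qed (rule Cons.IH, use Cons.prems in auto)
    ultimately show ?case by (simp add: x_def)
  qed (auto simp: semidirect_simps)
next
  case Nil
  then show ?case by (cases ks) (auto simp: semidirect_simps)
qed

lemma norm_shuffle_prod:
  assumes "\<And>v. cmod (f v) = 1"
  shows "cmod (shuffle_prod G f gs ks) = 1"
  using assms
  by (induction G f gs ks rule: shuffle_prod.induct) (simp_all add: norm_mult norm_power_int)

lemma shuffle_map_closed:
  assumes f: "f \<in> carrier (bar (semidirect G) n)"
  shows "shuffle_map G n f \<in> carrier (Tot (Cpq G) n)"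
proof -
  have "cmod (shuffle_prod G f gs ks) = 1" for gs ks
    using f by (intro norm_shuffle_prod) (simp add: bar_def)
  moreover have "shuffle_prod G f gs ks = 1"
    if "\<one> \<in> set gs \<or> \<one> \<in> set ks" "set gs \<subseteq> carrier G" "set ks \<subseteq> carrier G" for gs ks
    using shuffle_prod_normalized[of f gs ks] bar_normalized[OF f] that by blast
  ultimately show ?thesis by (auto simp: Tot_def Cpq_def shuffle_map_def)
qed

text \<open>
  Values of \<open>f\<close> on the 3-chain, built from the factorizations \<open>(a, g) = (a, 1)(1, g)\<close> and
  \<open>(1, g)(b, 1) = (g(b), 1)(1, g)\<close>, that joins \<open>[(a, g) | (b, h)]\<close> to its image under
  shuffle after Alexander-Whitney.
\<close>

definition ez_homotopy :: "(('a \<times> 'a) list \<Rightarrow> complex) \<Rightarrow> ('a \<times> 'a) list \<Rightarrow> complex" where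
  "ez_homotopy f ss = (case ss of
      [(a, g), (b, h)] \<Rightarrow>
        if {a, g, b, h} \<subseteq> carrier G
        then f [(\<one>, g), (b, \<one>), (\<one>, h)] * f [(a, \<one>), (cnj_act G g b, \<one>), (\<one>, g \<otimes> h)]
           / (f [(a, \<one>), (\<one>, g), (b, h)] * f [(cnj_act G g b, \<one>), (\<one>, g), (\<one>, h)])
        else 1
    | _ \<Rightarrow> 1)"

text \<open>If one of the two letters is the unit, each of the four 3-simplices in the formula
  contains a unit entry, so the value is 1.\<close>

lemma ez_homotopy_closed:
  assumes f: "f \<in> carrier (bar (semidirect G) 3)"
  shows "ez_homotopy f \<in> carrier (bar (semidirect G) 2)"
proof -
  have nf: "cmod (f v) = 1" for v using f by (simp add: bar_def)
  have "cmod (ez_homotopy f ss) = 1" for ss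
    by (auto simp: ez_homotopy_def norm_mult norm_divide nf split: list.splits)
  moreover have "ez_homotopy f ss = 1" if "\<one>\<^bsub>semidirect G\<^esub> \<in> set ss" for ss
    using that
    by (auto simp: ez_homotopy_def semidirect_simps cnj_act_simps bar_normalized[OF f] split: list.splits)
  moreover have "ez_homotopy f ss = 1" if "\<not> (length ss = 2 \<and> set ss \<subseteq> carrier (semidirect G))" for ss
    using that by (auto simp: ez_homotopy_def semidirect_simps split: list.splits)
  ultimately show ?thesis by (auto simp: bar_def)
qed

end

section \<open>The homotopy identity on 3-cocycles\<close>

lemma (in group) bar_cocycle_3:
  assumes f: "f \<in> carrier (bar G 3)" and d: "bar_d G 3 f = (\<lambda>_. 1)" and c: "{x, y, z, t} \<subseteq> carrier G"
  shows "f [y, z, t] * f [x, y \<otimes> z, t] * f [x, y, z] = f [x \<otimes> y, z, t] * f [x, y, z \<otimes> t]"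
  using bar_d_3[OF c, of f] by (simp add: d divide_simps bar_nonzero[OF f] mult_ac flip: divide_inverse)

text \<open>Separates the cocycle condition from the algebra: once a relation u = v is multiplied
  into the goal, only an identity between monomials is left.\<close>

lemma eq_by_relation:
  fixes u v x y :: "'b :: field"
  assumes "u = v" "v \<noteq> 0" "x * u = y * v"
  shows "x = y"
  using assms by simp

context group
begin

lemma cocycle_eq_AW_shuffle:
  assumes f: "f \<in> carrier (bar (semidirect G) 3)" and d: "bar_d (semidirect G) 3 f = (\<lambda>_. 1)"
    and c: "a \<in> carrier G" "b \<in> carrier G" "c \<in> carrier G" "g \<in> carrier G" "h \<in> carrier G" "k \<in> carrier G"
  shows "f [(a, g), (b, h), (c, k)] = AW_map G 3 (shuffle_map G 3 f) [(a, g), (b, h), (c, k)]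
     * bar_d (semidirect G) 2 (ez_homotopy f) [(a, g), (b, h), (c, k)]"
proof -
  let ?act = "cnj_act G"
  note cocycle = group.bar_cocycle_3[OF group_semidirect f d]
  note ev = semidirect_simps cnj_act_simps m_assoc c bar_normalized[OF f]
  note mult_cong = arg_cong2[where f = "(*) :: complex \<Rightarrow> complex \<Rightarrow> complex"]
  \<comment> \<open>These 4-simplices form the next term of the homotopy. They were found by solving for a
    4-chain whose boundary is \<open>id - EZ \<circ> AW - h \<circ> \<partial>\<close>; \<open>symmetric\<close> marks the coefficients \<open>+1\<close>,
    the others are \<open>-1\<close>.\<close>
  note rels =
    cocycle[of "(\<one>, g)" "(b, \<one>)" "(?act h c, \<one>)" "(\<one>, h \<otimes> k)"]
    cocycle[of "(?act g b, \<one>)" "(\<one>, g)" "(?act h c, \<one>)" "(\<one>, h \<otimes> k)", symmetric]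
    cocycle[of "(\<one>, g)" "(b, \<one>)" "(\<one>, h)" "(c, k)", symmetric]
    cocycle[of "(?act g b, \<one>)" "(\<one>, g)" "(\<one>, h)" "(c, k)"]
    cocycle[of "(a, \<one>)" "(?act g b, \<one>)" "(?act g (?act h c), \<one>)" "(\<one>, g \<otimes> (h \<otimes> k))"]
    cocycle[of "(\<one>, g)" "(?act h c, \<one>)" "(\<one>, h)" "(\<one>, k)", symmetric]
    cocycle[of "(?act g b, \<one>)" "(?act g (?act h c), \<one>)" "(\<one>, g)" "(\<one>, h \<otimes> k)"]
    cocycle[of "(\<one>, g)" "(\<one>, h)" "(c, \<one>)" "(\<one>, k)"]
    cocycle[of "(a, \<one>)" "(?act g b, \<one>)" "(\<one>, g \<otimes> h)" "(c, k)", symmetric]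
    cocycle[of "(?act g (?act h c), \<one>)" "(\<one>, g)" "(\<one>, h)" "(\<one>, k)"]
    cocycle[of "(a, \<one>)" "(\<one>, g)" "(b, h)" "(c, k)"]
  \<comment> \<open>Products of letters are put into normal form and degenerate simplices become 1,
    so that equal simplices in different relations become syntactically equal.\<close>
  note rels = rels[simplified ev, simplified]
  note rel = mult_cong[OF rels(1) mult_cong[OF rels(2) mult_cong[OF rels(3) mult_cong[OF rels(4)
    mult_cong[OF rels(5) mult_cong[OF rels(6) mult_cong[OF rels(7) mult_cong[OF rels(8)
    mult_cong[OF rels(9) mult_cong[OF rels(10) rels(11)]]]]]]]]]]
  show ?thesis
    \<comment> \<open>Multiplied by the product of all eleven relations, the two sides consist of
      the same values of \<open>f\<close>, which are nonzero and can be cancelled.\<close>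
    by (rule eq_by_relation[OF rel];
        (simp add: AW_map_def shuffle_map_def ez_homotopy_def atMost_numeral power_int_minus
          bar_d_2 ev bar_nonzero[OF f]);
        simp add: divide_simps bar_nonzero[OF f] flip: divide_inverse)
qed

lemma cocycle_homotopy:
  assumes f: "f \<in> cocycles (bar (semidirect G)) (bar_d (semidirect G)) 3"
  shows "f ss = AW_map G 3 (shuffle_map G 3 f) ss * bar_d (semidirect G) 2 (ez_homotopy f) ss"
proof (cases "length ss = 3 \<and> set ss \<subseteq> carrier (semidirect G)")
  case True
  have "f \<in> carrier (bar (semidirect G) 3)" "bar_d (semidirect G) 3 f = (\<lambda>_. 1)"
    using f by (auto simp: cocycles_def kernel_def bar_def)
  then show ?thesis
    using True cocycle_eq_AW_shuffle unfolding length_numeral_conv by (auto simp: semidirect_simps)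
next
  case False
  then show ?thesis using f by (auto simp: AW_map_def bar_d_def cocycles_def kernel_def bar_def)
qed

end

section \<open>The complexes in degree three\<close>

lemma mult_bar: "f \<otimes>\<^bsub>bar G n\<^esub> f' = (\<lambda>gs. f gs * f' gs)"
  and one_bar: "\<one>\<^bsub>bar G n\<^esub> = (\<lambda>gs. 1)"
  by (simp_all add: bar_def)

lemma bar_d_mult: "bar_d G n (\<lambda>gs. f gs * f' gs) = (\<lambda>gs. bar_d G n f gs * bar_d G n f' gs)"
  by (auto simp: bar_d_def prod.distrib power_int_mult_distrib)

lemma bar_d_one: "bar_d G n (\<lambda>gs. 1) = (\<lambda>gs. 1)"
  by (auto simp: bar_d_def)

text \<open>Normalization survives because a unit entry makes two adjacent faces equal with opposite
  signs, while every other face still contains the unit.\<close>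

lemma (in group) bar_d_2_closed:
  assumes f: "f \<in> carrier (bar G 2)"
  shows "bar_d G 2 f \<in> carrier (bar G 3)"
proof -
  have nf: "cmod (f gs) = 1" for gs using f by (simp add: bar_def)
  have "cmod (bar_d G 2 f gs) = 1" for gs
    by (auto simp: bar_d_def norm_mult norm_power_int norm_inverse nf simp flip: prod_norm)
  moreover have "bar_d G 2 f gs = 1" if "\<one> \<in> set gs" for gs
  proof (cases "length gs = 3 \<and> set gs \<subseteq> carrier G")
    case True
    then obtain x y z where "gs = [x, y, z]" unfolding length_numeral_conv by blast
    then show ?thesis using True that
      by (auto simp: bar_d_2 bar_normalized[OF f] bar_nonzero[OF f])
  qed (auto simp: bar_d_def)
  moreover have "bar_d G 2 f gs = 1" if "\<not> (length gs = 3 \<and> set gs \<subseteq> carrier G)" for gs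
    using that by (auto simp: bar_d_def)
  ultimately show ?thesis unfolding bar_def by auto
qed

lemma (in group) cochain_degree_bar: "cochain_degree (bar G) (bar_d G) 3"
proof -
  have "bar_d G 2 \<in> hom (bar G 2) (bar G 3)"
    by (rule homI) (simp_all add: bar_d_2_closed mult_bar bar_d_mult)
  then show ?thesis
    using cochain_degreeI[of "bar G" 2 "bar_d G"]
    by (simp add: comm_group_bar mult_bar one_bar bar_d_mult bar_d_one numeral_3_eq_3[symmetric])
qed

lemma delta_G_mult:
  "delta_G G p q (\<lambda>gs ks. F gs ks * F' gs ks) = (\<lambda>gs ks. delta_G G p q F gs ks * delta_G G p q F' gs ks)"
  by (auto simp: delta_G_def prod.distrib power_int_mult_distrib fun_eq_iff)

lemma delta_K_mult:
  "delta_K G p q (\<lambda>gs ks. F gs ks * F' gs ks) = (\<lambda>gs ks. delta_K G p q F gs ks * delta_K G p q F' gs ks)"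
  by (auto simp: delta_K_def prod.distrib power_int_mult_distrib fun_eq_iff)

lemma delta_G_trivial: "delta_G G p q (\<lambda>gs ks. 1) = (\<lambda>gs ks. 1)"
  and delta_K_trivial: "delta_K G p q (\<lambda>gs ks. 1) = (\<lambda>gs ks. 1)"
  by (auto simp: delta_G_def delta_K_def fun_eq_iff)

lemma mult_Tot:
  "F \<otimes>\<^bsub>Tot (Cpq G) n\<^esub> F' = (\<lambda>p\<in>{..n}. \<lambda>gs ks. F p gs ks * F' p gs ks)"
  "F \<otimes>\<^bsub>Tot (Apq G) n\<^esub> F' = (\<lambda>p\<in>{..n}. \<lambda>gs ks. F p gs ks * F' p gs ks)"
  "F \<otimes>\<^bsub>Tot (Bpq G) n\<^esub> F' = (\<lambda>p\<in>{..n}. \<lambda>gs ks. F p gs ks * F' p gs ks)"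
  by (auto simp: Tot_def Cpq_def Apq_def Bpq_def fun_eq_iff)

lemma one_Tot:
  "\<one>\<^bsub>Tot (Cpq G) n\<^esub> = (\<lambda>p\<in>{..n}. \<lambda>gs ks. 1)"
  "\<one>\<^bsub>Tot (Apq G) n\<^esub> = (\<lambda>p\<in>{..n}. \<lambda>gs ks. 1)"
  "\<one>\<^bsub>Tot (Bpq G) n\<^esub> = (\<lambda>p\<in>{..n}. \<lambda>gs ks. 1)"
  by (auto simp: Tot_def Cpq_def Apq_def Bpq_def fun_eq_iff)

lemma Tot_d_mult:
  "Tot_d G n (\<lambda>p\<in>{..n}. \<lambda>gs ks. F p gs ks * F' p gs ks) =
     (\<lambda>p\<in>{..Suc n}. \<lambda>gs ks. Tot_d G n F p gs ks * Tot_d G n F' p gs ks)"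
proof
  fix p
  have "p - 1 \<le> n" if "p \<le> Suc n" using that by auto
  then show "Tot_d G n (\<lambda>p\<in>{..n}. \<lambda>gs ks. F p gs ks * F' p gs ks) p =
     (\<lambda>p\<in>{..Suc n}. \<lambda>gs ks. Tot_d G n F p gs ks * Tot_d G n F' p gs ks) p"
    by (auto simp: Tot_d_def delta_G_mult delta_K_mult power_int_mult_distrib fun_eq_iff)
qed

lemma Tot_d_one: "Tot_d G n (\<lambda>p\<in>{..n}. \<lambda>gs ks. 1) = (\<lambda>p\<in>{..Suc n}. \<lambda>gs ks. 1)"
proof
  fix p
  have "p - 1 \<le> n" if "p \<le> Suc n" using that by auto
  then show "Tot_d G n (\<lambda>p\<in>{..n}. \<lambda>gs ks. 1) p = (\<lambda>p\<in>{..Suc n}. \<lambda>gs ks. 1) p"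
    by (auto simp: Tot_d_def delta_G_trivial delta_K_trivial fun_eq_iff)
qed

lemma carrier_Tot_Cpq_iff:
  "F \<in> carrier (Tot (Cpq G) n) \<longleftrightarrow> supported G n F \<and>
     (\<forall>p\<le>n. \<forall>gs ks. cmod (F p gs ks) = 1 \<and> (\<one>\<^bsub>G\<^esub> \<in> set gs \<union> set ks \<longrightarrow> F p gs ks = 1))"
  unfolding Tot_def Cpq_def supported_def by (simp add: PiE_iff) blast

lemma carrier_Tot_Apq:
  "carrier (Tot (Apq G) n) = {F \<in> carrier (Tot (Cpq G) n). F n = (\<lambda>gs ks. 1)}"
proof -
  have "F p \<in> carrier (Apq G p (n - p)) \<longleftrightarrow>
      F p \<in> carrier (Cpq G p (n - p)) \<and> (p = n \<longrightarrow> F n = (\<lambda>gs ks. 1))" if "p \<le> n" for F p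
    using that by (auto simp: Apq_def Cpq_def)
  then show ?thesis unfolding Tot_def carrier_product_group set_eq_iff mem_Collect_eq PiE_iff Ball_def atMost_iff
    by (metis le_refl)
qed

lemma carrier_Tot_Bpq:
  assumes "n > 0"
  shows "carrier (Tot (Bpq G) n) =
    {F \<in> carrier (Tot (Cpq G) n). F n = (\<lambda>gs ks. 1) \<and> F 0 = (\<lambda>gs ks. 1)}"
proof -
  have "F p \<in> carrier (Bpq G p (n - p)) \<longleftrightarrow>
      F p \<in> carrier (Cpq G p (n - p)) \<and> (p = n \<longrightarrow> F n = (\<lambda>gs ks. 1)) \<and> (p = 0 \<longrightarrow> F 0 = (\<lambda>gs ks. 1))"
    if "p \<le> n" for F p
    using that assms by (auto simp: Bpq_def Cpq_def)
  then show ?thesis unfolding Tot_def carrier_product_group set_eq_iff mem_Collect_eq PiE_iff Ball_def atMost_iff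
    by (metis le_refl le0)
qed

lemma comm_group_Tot:
  "comm_group (Tot (Cpq G) n)" "comm_group (Tot (Apq G) n)" "comm_group (Tot (Bpq G) n)"
proof -
  have prod: "comm_group (product_group I H)" if "\<And>i. i \<in> I \<Longrightarrow> comm_group (H i)"
    for I :: "nat set" and H :: "nat \<Rightarrow> 'a bicochain monoid"
    using that
    by (intro group.group_comm_groupI product_group)
      (auto simp: comm_group_def PiE_iff intro!: restrict_ext comm_monoid.m_comm)
  have triv: "comm_group ((Cpq G p q)\<lparr>carrier := {\<one>\<^bsub>Cpq G p q\<^esub>}\<rparr>)" for p q
    by (rule comm_groupI) (auto simp: Cpq_def)
  show "comm_group (Tot (Cpq G) n)" "comm_group (Tot (Apq G) n)" "comm_group (Tot (Bpq G) n)"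
    unfolding Tot_def
    using comm_group_Cpq triv by (auto intro!: prod simp: Apq_def Bpq_def)
qed

lemma (in group) Tot_d_2_closed:
  assumes F: "F \<in> carrier (Tot (Cpq G) 2)"
  shows "Tot_d G 2 F \<in> carrier (Tot (Cpq G) 3)"
proof -
  have nF: "cmod (F p gs ks) = 1" if "p \<le> 2" for p gs ks
    using F that by (simp add: carrier_Tot_Cpq_iff)
  have "cmod (delta_G G p q (F p) gs ks) = 1" "cmod (delta_K G p q (F p) gs ks) = 1"
    if "p \<le> 2" for p q gs ks
    using that by (auto simp: delta_G_def delta_K_def norm_mult norm_power_int norm_inverse nF simp flip: prod_norm)
  then have n: "cmod (Tot_d G 2 F p gs ks) = 1" if "p \<le> 3" for p gs ks
    using that by (auto simp: Tot_d_def norm_mult norm_power_int)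
  have supp: "supported G 3 (Tot_d G 2 F)"
    using supported_Tot_d[of G 2] by simp
  \<comment> \<open>\<open>D\<close> is the differential forced to be 1 on simplices with a unit
    entry. Equality with \<open>D\<close> is therefore normalization, stated so that
    \<open>supported_3_eqI\<close> can split it into bidegrees.\<close>
  define D where "D = (\<lambda>p\<in>{..3}. \<lambda>gs ks. if \<one> \<in> set gs \<union> set ks then 1 else Tot_d G 2 F p gs ks)"
  have "Tot_d G 2 F = D"
  proof (rule supported_3_eqI[OF supp])
    show "supported G 3 D" using supp by (auto simp: supported_def D_def)
  qed (auto simp: D_def Tot_d_def d_eval cnj_act_simps Tot_nonzero[OF F] Tot_normalized[OF F]
        power_int_minus)
  then have D: "Tot_d G 2 F p gs ks = D p gs ks" for p gs ks
    by (rule arg_cong)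
  have "Tot_d G 2 F p gs ks = 1" if "p \<le> 3" "\<one> \<in> set gs \<union> set ks" for p gs ks
    unfolding D using that by (simp add: D_def)
  with supp n show ?thesis by (auto simp: carrier_Tot_Cpq_iff)
qed

text \<open>The row q = 0 receives only \<open>delta_G\<close> from itself, hence \<open>Apq\<close>
  is stable under the differential.\<close>

lemma Tot_d_top:
  assumes "F n = (\<lambda>gs ks. 1)" shows "Tot_d G n F (Suc n) = (\<lambda>gs ks. 1)"
  using assms by (auto simp: Tot_d_def delta_G_trivial)

text \<open>The column p = 0 receives only \<open>delta_K\<close> from itself; together with the row
  q = 0 this makes \<open>Bpq\<close> stable.\<close>

lemma Tot_d_0:
  assumes "F 0 = (\<lambda>gs ks. 1)" shows "Tot_d G n F 0 = (\<lambda>gs ks. 1)"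
  using assms by (auto simp: Tot_d_def delta_K_trivial)

lemma (in group) Tot_d_2_hom:
  "Tot_d G 2 \<in> hom (Tot (Cpq G) 2) (Tot (Cpq G) 3)"
  "Tot_d G 2 \<in> hom (Tot (Apq G) 2) (Tot (Apq G) 3)"
  "Tot_d G 2 \<in> hom (Tot (Bpq G) 2) (Tot (Bpq G) 3)"
  using Tot_d_mult[of G 2] Tot_d_2_closed Tot_d_top[of _ 2 G] Tot_d_0[of _ G 2]
  by (auto intro!: homI simp: mult_Tot carrier_Tot_Apq carrier_Tot_Bpq)

lemma (in group) cochain_degree_Tot:
  "cochain_degree (Tot (Cpq G)) (Tot_d G) 3"
  "cochain_degree (Tot (Apq G)) (Tot_d G) 3"
  "cochain_degree (Tot (Bpq G)) (Tot_d G) 3"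
proof -
  \<comment> \<open>Multiplication in \<open>Tot\<close> restricts to the index set; as
    \<open>Tot_d\<close> is already restricted, multiplying by the unit returns it
    unchanged.\<close>
  have r: "restrict (Tot_d G (Suc 2) F) {..Suc (Suc 2)} = Tot_d G (Suc 2) F" for F
    unfolding Tot_d_def by auto
  have "cochain_degree C (Tot_d G) 3"
    if "C \<in> {Tot (Cpq G), Tot (Apq G), Tot (Bpq G)}" for C
  proof -
    have "cochain_degree C (Tot_d G) (Suc 2)"
    proof (rule cochain_degreeI)
      show "comm_group (C (Suc 2))" "comm_group (C 2)"
        using that comm_group_Tot by auto
      show "Tot_d G 2 \<in> hom (C 2) (C (Suc 2))"
        using that Tot_d_2_hom by auto
      show "Tot_d G (Suc 2) (x \<otimes>\<^bsub>C (Suc 2)\<^esub> y) = Tot_d G (Suc 2) x \<otimes>\<^bsub>C (Suc (Suc 2))\<^esub> Tot_d G (Suc 2) y" for x y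
        using that Tot_d_mult[of G "Suc 2"] by (auto simp only: mult_Tot insert_iff empty_iff)
      show "Tot_d G (Suc 2) \<one>\<^bsub>C (Suc 2)\<^esub> = \<one>\<^bsub>C (Suc (Suc 2))\<^esub>"
        using that Tot_d_one[of G "Suc 2"] by (auto simp only: one_Tot insert_iff empty_iff)
      show "Tot_d G (Suc 2) x \<otimes>\<^bsub>C (Suc (Suc 2))\<^esub> \<one>\<^bsub>C (Suc (Suc 2))\<^esub> = Tot_d G (Suc 2) x" for x
        using that r[of x] by (auto simp: mult_Tot one_Tot fun_eq_iff restrict_def Tot_d_def)
    qed
    then show ?thesis by simp
  qed
  then show "cochain_degree (Tot (Cpq G)) (Tot_d G) 3"
    "cochain_degree (Tot (Apq G)) (Tot_d G) 3" "cochain_degree (Tot (Bpq G)) (Tot_d G) 3"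
    by blast+
qed

section \<open>Pullbacks, and the two summands of the double complex\<close>

lemma merge_map:
  assumes "\<phi> \<in> hom H G" "set xs \<subseteq> carrier H" "1 \<le> i" "i < length xs"
  shows "merge G i (map \<phi> xs) = map \<phi> (merge H i xs)"
proof -
  have "xs ! (i - 1) \<in> carrier H" "xs ! i \<in> carrier H"
    using assms nth_mem[of "i - 1" xs] nth_mem[of i xs] by auto
  then show ?thesis
    using assms by (simp add: merge_def take_map drop_map hom_mult)
qed

lemma pullback_bar_d:
  assumes "group H" "\<phi> \<in> hom H G"
  shows "pullback H \<phi> (Suc n) (bar_d G n f) = bar_d H n (pullback H \<phi> n f)"
proof
  interpret H: group H by fact
  fix xs
  show "pullback H \<phi> (Suc n) (bar_d G n f) xs = bar_d H n (pullback H \<phi> n f) xs"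
  proof (cases "length xs = Suc n \<and> set xs \<subseteq> carrier H")
    case True
    then have xs: "length xs = Suc n" "set xs \<subseteq> carrier H" "set (map \<phi> xs) \<subseteq> carrier G"
      using assms by (auto simp: hom_def)
    have set_tl: "set (tl xs) \<subseteq> set xs" by (cases xs) auto
    have "pullback H \<phi> n f (merge H i xs) = f (merge G i (map \<phi> xs))" if i: "i \<in> {1..n}" for i
    proof -
      have "xs ! (i - 1) \<in> carrier H" "xs ! i \<in> carrier H"
        using i xs nth_mem[of "i - 1" xs] nth_mem[of i xs] by auto
      then have "set (merge H i xs) \<subseteq> carrier H" "length (merge H i xs) = n"
        using i xs set_take_subset[of "i - 1" xs] set_drop_subset[of "i + 1" xs]
        by (auto simp: merge_def)
      then show ?thesis
        using merge_map[OF assms(2) xs(2), of i] i xs(1) by (simp add: pullback_def)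
    qed
    moreover have "pullback H \<phi> n f (tl xs) = f (tl (map \<phi> xs))"
      "pullback H \<phi> n f (butlast xs) = f (butlast (map \<phi> xs))"
      using xs set_tl in_set_butlastD[of _ xs]
      by (auto simp: pullback_def map_tl map_butlast)
    ultimately show ?thesis using xs by (simp add: pullback_def bar_d_def)
  qed (auto simp: pullback_def bar_d_def)
qed

lemma pullback_closed:
  assumes "group H" "group G" "\<phi> \<in> hom H G" "f \<in> carrier (bar G n)"
  shows "pullback H \<phi> n f \<in> carrier (bar H n)"
proof -
  have one: "\<phi> \<one>\<^bsub>H\<^esub> = \<one>\<^bsub>G\<^esub>" using assms hom_one by blast
  have "f (map \<phi> xs) = 1" if "\<one>\<^bsub>H\<^esub> \<in> set xs" for xs
    by (rule bar_normalized[OF assms(4)]) (use that one in force)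
  moreover have "cmod (f xs) = 1" for xs
    using assms(4) by (simp add: bar_def)
  ultimately show ?thesis
    by (simp add: pullback_def bar_def)
qed

lemma pullback_mult:
  "pullback H \<phi> n (\<lambda>gs. f gs * f' gs) = (\<lambda>gs. pullback H \<phi> n f gs * pullback H \<phi> n f' gs)"
  by (auto simp: pullback_def)

text \<open>a (g b g^-1) g h = (a g)(b h).\<close>

lemma (in group) mu_hom: "mu G \<in> hom (semidirect G) G"
  by (auto simp: hom_def mu_def semidirect_simps m_assoc cnj_act_simps)

section \<open>The projections to the two summands and their common inverse\<close>

lemma A_part_closed:
  assumes F: "F \<in> carrier (Tot (Cpq G) n)"
  shows "A_part n F \<in> carrier (Tot (Apq G) n)"
proof -
  have "F p \<in> carrier (Cpq G p (n - p))" if "p < n" for p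
    using that Tot_CpqD[OF F, of p] by simp
  moreover have "(\<lambda>gs ks. 1) \<in> carrier (Cpq G n 0)"
    by (simp add: Cpq_def)
  ultimately have "A_part n F \<in> carrier (Tot (Cpq G) n)"
    by (auto simp: Tot_def A_part_def)
  then show ?thesis by (simp add: carrier_Tot_Apq A_part_def)
qed

lemma A_part_mult:
  "A_part n (\<lambda>p\<in>{..n}. \<lambda>gs ks. F p gs ks * F' p gs ks) =
     (\<lambda>p\<in>{..n}. \<lambda>gs ks. A_part n F p gs ks * A_part n F' p gs ks)"
  by (auto simp: A_part_def fun_eq_iff)

text \<open>Discarding \<open>F n\<close> could change the component p = n only through
  \<open>delta_K\<close> from the row q = 0, and that factor is a quotient of two equal nonzero
  values.\<close>

lemma A_part_Tot_d:
  assumes F: "F \<in> carrier (Tot (Cpq G) n)"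
  shows "A_part (Suc n) (Tot_d G n F) = Tot_d G n (A_part n F)"
proof
  fix p
  have "delta_K G n 0 (F n) gs ks = 1" for gs ks
    using Tot_nonzero[OF F, of n] by (auto simp: delta_K_def length_Suc_conv)
  note K = this
  consider "p < n" | "p = n" | "p = Suc n" | "p > Suc n" by linarith
  then show "A_part (Suc n) (Tot_d G n F) p = Tot_d G n (A_part n F) p"
    by cases (auto simp: K A_part_def Tot_d_def delta_G_trivial delta_K_trivial fun_eq_iff)
qed

lemma row_part_closed: "F \<in> carrier (Tot (Cpq G) n) \<Longrightarrow> row_part n F \<in> carrier (bar G n)"
  by (drule Tot_CpqD[of _ _ _ n]) (simp_all add: Cpq_def bar_def row_part_def, blast)

lemma row_part_mult:
  "row_part n (\<lambda>p\<in>{..n}. \<lambda>gs ks. F p gs ks * F' p gs ks) = (\<lambda>gs. row_part n F gs * row_part n F' gs)"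
  by (auto simp: row_part_def)

lemma row_part_Tot_d: "row_part (Suc n) (Tot_d G n F) = bar_d G n (row_part n F)"
  by (rule ext) (simp add: row_part_def Tot_d_def delta_G_def bar_d_def)

lemma A_row_eqI:
  fixes F F' :: "nat \<Rightarrow> 'a bicochain"
  assumes "supported G n F" "supported G n F'"
    and "A_part n F = A_part n F'" "row_part n F = row_part n F'"
  shows "F = F'"
proof (rule supported_eqI[OF assms(1,2)])
  fix p and gs ks :: "'a list" assume *: "p \<le> n" "length gs = p" "length ks = n - p"
  show "F p gs ks = F' p gs ks"
  proof (cases "p = n")
    case True
    then show ?thesis using * fun_cong[OF assms(4), of gs] by (simp add: row_part_def)
  next
    case False
    then show ?thesis using * fun_cong[OF assms(3), of p] by (simp add: A_part_def)
  qed
qed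

text \<open>Inverse to the pair of \<open>A_part\<close> and \<open>row_part\<close>: it puts
  \<open>r\<close> back in bidegree (n, 0).\<close>

definition glue :: "nat \<Rightarrow> (nat \<Rightarrow> 'a bicochain) \<Rightarrow> ('a list \<Rightarrow> complex) \<Rightarrow> nat \<Rightarrow> 'a bicochain" where
  "glue n F r = (\<lambda>p\<in>{..n}. if p < n then F p else (\<lambda>gs ks. if ks = [] then r gs else 1))"

lemma glue_closed:
  assumes "F \<in> carrier (Tot (Apq G) n)" "r \<in> carrier (bar G n)"
  shows "glue n F r \<in> carrier (Tot (Cpq G) n)"
proof -
  have "F p \<in> carrier (Cpq G p (n - p))" if "p < n" for p
    using assms(1) that Tot_CpqD[of F G n p] by (simp add: carrier_Tot_Apq)
  moreover have "(\<lambda>gs ks. if ks = [] then r gs else 1) \<in> carrier (Cpq G n 0)"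
    using assms(2) by (simp add: bar_def Cpq_def) blast
  ultimately show ?thesis
    by (auto simp: Tot_def glue_def)
qed

lemma A_part_glue:
  assumes "F \<in> carrier (Tot (Apq G) n)" shows "A_part n (glue n F r) = F"
proof (rule extensionalityI[of _ "{..n}"])
  show "F \<in> extensional {..n}" using assms by (simp add: Tot_def PiE_def)
  have "F n = (\<lambda>gs ks. 1)" using assms by (simp add: carrier_Tot_Apq)
  then show "A_part n (glue n F r) p = F p" if "p \<in> {..n}" for p
    using that by (simp add: A_part_def glue_def)
qed (simp add: A_part_def)

lemma row_part_glue: "row_part n (glue n F r) = r"
  by (auto simp: row_part_def glue_def)

section \<open>The canonical isomorphism\<close>

lemma A_part_hom: "A_part n \<in> hom (Tot (Cpq G) n) (Tot (Apq G) n)"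
  by (rule homI) (simp_all add: A_part_closed mult_Tot A_part_mult)

lemma row_part_hom: "row_part n \<in> hom (Tot (Cpq G) n) (bar G n)"
  by (rule homI) (simp_all add: row_part_closed mult_Tot mult_bar row_part_mult)

lemma pullback_hom:
  assumes "group H" "group G" "\<phi> \<in> hom H G"
  shows "pullback H \<phi> n \<in> hom (bar G n) (bar H n)"
  by (rule homI) (simp_all add: pullback_closed[OF assms] mult_bar pullback_mult)

lemma shuffle_prod_mult:
  "shuffle_prod G (\<lambda>v. f v * f' v) gs ks = shuffle_prod G f gs ks * shuffle_prod G f' gs ks"
  by (induction G f gs ks arbitrary: f' rule: shuffle_prod.induct)
    (simp_all add: power_int_mult_distrib)

lemma shuffle_map_one: "shuffle_map G n (\<lambda>v. 1) = (\<lambda>p\<in>{..n}. \<lambda>gs ks. 1)"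
  by (auto simp: shuffle_map_def shuffle_prod_one fun_eq_iff)

lemma A_part_one: "A_part n (\<lambda>p\<in>{..n}. \<lambda>gs ks. 1) = (\<lambda>p\<in>{..n}. \<lambda>gs ks. 1)"
  by (auto simp: A_part_def)

lemma row_part_one: "row_part n (\<lambda>p\<in>{..n}. \<lambda>gs ks. 1) = (\<lambda>gs. 1)"
  by (rule ext) (simp add: row_part_def)

context group
begin

lemma shuffle_map_hom: "shuffle_map G n \<in> hom (bar (semidirect G) n) (Tot (Cpq G) n)"
proof (rule homI)
  show "shuffle_map G n (f \<otimes>\<^bsub>bar (semidirect G) n\<^esub> f') =
    shuffle_map G n f \<otimes>\<^bsub>Tot (Cpq G) n\<^esub> shuffle_map G n f'" for f f'
    by (auto simp: mult_Tot mult_bar shuffle_map_def shuffle_prod_mult fun_eq_iff)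
qed (rule shuffle_map_closed)

lemma EZ_class_class:
  assumes "f \<in> carrier (bar (semidirect G) 3)"
  shows "EZ_class G 3 (coh_class (bar (semidirect G)) (bar_d (semidirect G)) 3 f) =
    coh_class (Tot (Cpq G)) (Tot_d G) 3 (shuffle_map G 3 f)"
  unfolding EZ_class_def
  using group.cochain_degree_bar[OF group_semidirect] cochain_degree_Tot(1) shuffle_map_hom
    shuffle_map_bar_d_2 assms
  by (rule induced_map_class_3)

lemma split_class_class:
  assumes "F \<in> carrier (Tot (Cpq G) 3)"
  shows "split_class G 3 (coh_class (Tot (Cpq G)) (Tot_d G) 3 F) =
    (coh_class (Tot (Apq G)) (Tot_d G) 3 (A_part 3 F), coh_class (bar G) (bar_d G) 3 (row_part 3 F))"
proof -
  have "A_part 3 (Tot_d G 2 F) = Tot_d G 2 (A_part 2 F)" if "F \<in> carrier (Tot (Cpq G) 2)" for F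
    using A_part_Tot_d[OF that] by simp
  moreover have "row_part 3 (Tot_d G 2 F) = bar_d G 2 (row_part 2 F)" for F
    using row_part_Tot_d[of 2 G F] by simp
  ultimately show ?thesis
    unfolding split_class_def
    using induced_map_class_3[OF cochain_degree_Tot(1) cochain_degree_Tot(2) A_part_hom _ assms]
      induced_map_class_3[OF cochain_degree_Tot(1) cochain_degree_bar row_part_hom _ assms]
    by simp
qed

lemma canonical_iso_class:
  assumes "f \<in> carrier (bar (semidirect G) 3)"
  shows "canonical_iso G 3 (coh_class (bar (semidirect G)) (bar_d (semidirect G)) 3 f) =
    (coh_class (Tot (Apq G)) (Tot_d G) 3 (A_part 3 (shuffle_map G 3 f)),
     coh_class (bar G) (bar_d G) 3 (row_part 3 (shuffle_map G 3 f)))"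
  using assms by (simp add: canonical_iso_def EZ_class_class split_class_class shuffle_map_closed)

lemma shuffle_map_cocycle:
  assumes "f \<in> cocycles (bar (semidirect G)) (bar_d (semidirect G)) 3"
  shows "shuffle_map G 3 f \<in> cocycles (Tot (Cpq G)) (Tot_d G) 3"
  using assms shuffle_map_bar_d_3[of f]
  by (simp add: cocycles_3 shuffle_map_closed one_bar one_Tot shuffle_map_one)

lemma A_part_cocycle:
  assumes "F \<in> cocycles (Tot (Cpq G)) (Tot_d G) 3"
  shows "A_part 3 F \<in> cocycles (Tot (Apq G)) (Tot_d G) 3"
  using assms A_part_Tot_d[of F G 3]
  by (simp add: cocycles_3 A_part_closed one_Tot A_part_one)

lemma row_part_cocycle:
  assumes "F \<in> cocycles (Tot (Cpq G)) (Tot_d G) 3"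
  shows "row_part 3 F \<in> cocycles (bar G) (bar_d G) 3"
  using assms row_part_Tot_d[of 3 G F]
  by (simp add: cocycles_3 row_part_closed one_Tot one_bar row_part_one)

lemma glue_cocycle:
  assumes a: "a \<in> cocycles (Tot (Apq G)) (Tot_d G) 3" and r: "r \<in> cocycles (bar G) (bar_d G) 3"
  shows "glue 3 a r \<in> cocycles (Tot (Cpq G)) (Tot_d G) 3"
proof -
  have closed: "glue 3 a r \<in> carrier (Tot (Cpq G) 3)"
    using a r glue_closed[of a G 3 r] by (simp add: cocycles_3)
  have "Tot_d G 3 (glue 3 a r) = (\<lambda>p\<in>{..4}. \<lambda>gs ks. 1)"
  proof (rule A_row_eqI)
    show "supported G 4 (Tot_d G 3 (glue 3 a r))" using supported_Tot_d[of G 3] by simp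
    show "A_part 4 (Tot_d G 3 (glue 3 a r)) = A_part 4 (\<lambda>p\<in>{..4}. \<lambda>gs ks. 1)"
      using a A_part_Tot_d[OF closed] A_part_glue[of a G 3 r]
      by (simp add: cocycles_3 one_Tot A_part_one)
    show "row_part 4 (Tot_d G 3 (glue 3 a r)) = row_part 4 (\<lambda>p\<in>{..4}. \<lambda>gs ks. 1)"
      using r row_part_Tot_d[of 3 G "glue 3 a r"]
      by (simp add: row_part_glue cocycles_3 one_bar row_part_one)
  qed (auto simp: supported_def)
  then show ?thesis using closed by (simp add: cocycles_3 one_Tot)
qed

lemma AW_map_cocycle:
  assumes "F \<in> cocycles (Tot (Cpq G)) (Tot_d G) 3"
  shows "AW_map G 3 F \<in> cocycles (bar (semidirect G)) (bar_d (semidirect G)) 3"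
proof -
  have "AW_map G 4 (\<lambda>p\<in>{..4}. \<lambda>gs ks. 1) = (\<lambda>ss. 1)"
    by (simp add: AW_map_def fun_eq_iff)
  then show ?thesis
    using assms AW_map_Tot_d_3[of F] by (simp add: cocycles_3 AW_map_closed one_Tot one_bar)
qed

text \<open>The homotopy writes \<open>f\<close> as \<open>AW_map\<close> of its shuffle image times
  a coboundary. If that image is the differential of \<open>F\<close>, the first factor is the
  coboundary of \<open>AW_map G 2 F\<close>, so the product of the two cochains bounds
  \<open>f\<close>.\<close>

lemma shuffle_map_coboundaryD:
  assumes f: "f \<in> cocycles (bar (semidirect G)) (bar_d (semidirect G)) 3"
    and F: "F \<in> carrier (Tot (Cpq G) 2)" "shuffle_map G 3 f = Tot_d G 2 F"
  shows "f \<in> coboundaries (bar (semidirect G)) (bar_d (semidirect G)) 3"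
proof -
  let ?h = "\<lambda>ss. AW_map G 2 F ss * ez_homotopy f ss"
  interpret B: comm_group "bar (semidirect G) 2" by (rule comm_group_bar)
  have "f \<in> carrier (bar (semidirect G) 3)" using f by (simp add: cocycles_3)
  then have "?h \<in> carrier (bar (semidirect G) 2)"
    using B.m_closed[OF AW_map_closed[OF F(1)] ez_homotopy_closed[of f]] by (simp add: mult_bar)
  moreover have "f = bar_d (semidirect G) 2 ?h"
  proof
    fix ss
    have "f ss = AW_map G 3 (Tot_d G 2 F) ss * bar_d (semidirect G) 2 (ez_homotopy f) ss"
      unfolding F(2)[symmetric] by (rule cocycle_homotopy[OF f])
    then show "f ss = bar_d (semidirect G) 2 ?h ss"
      by (simp only: AW_map_Tot_d_2[OF F(1)] bar_d_mult)
  qed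
  ultimately show ?thesis unfolding coboundaries_3 by blast
qed

theorem canonical_iso_iso:
  "canonical_iso G 3 \<in> iso (H_group (semidirect G) 3) (H_Tot G (Apq G) 3 \<times>\<times> H_group G 3)"
proof (rule cochain_degree.iso_cohomologyI[OF group.cochain_degree_bar[OF group_semidirect]])
  interpret A: cochain_degree "Tot (Apq G)" "Tot_d G" 3 by (rule cochain_degree_Tot)
  interpret R: cochain_degree "bar G" "bar_d G" 3 by (rule cochain_degree_bar)
  let ?Z = "cocycles (bar (semidirect G)) (bar_d (semidirect G)) 3"
  let ?a = "\<lambda>f. A_part 3 (shuffle_map G 3 f)" and ?r = "\<lambda>f. row_part 3 (shuffle_map G 3 f)"
  let ?\<phi> = "\<lambda>f. (coh_class (Tot (Apq G)) (Tot_d G) 3 (?a f), coh_class (bar G) (bar_d G) 3 (?r f))"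
  have a: "?a f \<in> cocycles (Tot (Apq G)) (Tot_d G) 3" and r: "?r f \<in> cocycles (bar G) (bar_d G) 3"
    if "f \<in> ?Z" for f
    using that shuffle_map_cocycle A_part_cocycle row_part_cocycle by blast+
  show "canonical_iso G 3 (coh_class (bar (semidirect G)) (bar_d (semidirect G)) 3 f) = ?\<phi> f"
    if "f \<in> ?Z" for f
    using that by (intro canonical_iso_class) (simp add: cocycles_3)
  show "?\<phi> (f \<otimes>\<^bsub>bar (semidirect G) 3\<^esub> f') = ?\<phi> f \<otimes>\<^bsub>H_Tot G (Apq G) 3 \<times>\<times> H_group G 3\<^esub> ?\<phi> f'"
    if "f \<in> ?Z" "f' \<in> ?Z" for f f'
  proof -
    have "f \<in> carrier (bar (semidirect G) 3)" "f' \<in> carrier (bar (semidirect G) 3)"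
      using that by (simp_all add: cocycles_3)
    then have "?a (f \<otimes>\<^bsub>bar (semidirect G) 3\<^esub> f') = ?a f \<otimes>\<^bsub>Tot (Apq G) 3\<^esub> ?a f'"
      "?r (f \<otimes>\<^bsub>bar (semidirect G) 3\<^esub> f') = ?r f \<otimes>\<^bsub>bar G 3\<^esub> ?r f'"
      using hom_mult[OF shuffle_map_hom] hom_mult[OF A_part_hom] hom_mult[OF row_part_hom]
        shuffle_map_closed by metis+
    then show ?thesis
      using that a[THEN A.cocyclesD] r[THEN R.cocyclesD]
      by (simp add: A.mult_class R.mult_class)
  qed
  show "?\<phi> ` ?Z = carrier (H_Tot G (Apq G) 3 \<times>\<times> H_group G 3)"
  proof
    show "?\<phi> ` ?Z \<subseteq> carrier (H_Tot G (Apq G) 3 \<times>\<times> H_group G 3)"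
      using a r by (auto simp: A.carrier_cohomology R.carrier_cohomology)
    show "carrier (H_Tot G (Apq G) 3 \<times>\<times> H_group G 3) \<subseteq> ?\<phi> ` ?Z"
    proof
      fix u assume "u \<in> carrier (H_Tot G (Apq G) 3 \<times>\<times> H_group G 3)"
      then obtain a r where u: "u = (coh_class (Tot (Apq G)) (Tot_d G) 3 a, coh_class (bar G) (bar_d G) 3 r)"
        and ar: "a \<in> cocycles (Tot (Apq G)) (Tot_d G) 3" "r \<in> cocycles (bar G) (bar_d G) 3"
        by (auto simp: A.carrier_cohomology R.carrier_cohomology)
      \<comment> \<open>\<open>glue\<close> inverts the two projections, and \<open>AW_map\<close>
        is a right inverse of the shuffle map already on cochains.\<close>
      let ?f = "AW_map G 3 (glue 3 a r)"
      have "shuffle_map G 3 ?f = glue 3 a r"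
        using glue_cocycle[OF ar] by (simp add: cocycles_3 shuffle_map_AW_map_3)
      then have "?\<phi> ?f = u"
        using ar A_part_glue[of a G 3 r] by (simp add: u row_part_glue cocycles_3)
      moreover have "?f \<in> ?Z" using AW_map_cocycle glue_cocycle[OF ar] by blast
      ultimately show "u \<in> ?\<phi> ` ?Z" by blast
    qed
  qed
  show "f \<in> coboundaries (bar (semidirect G)) (bar_d (semidirect G)) 3"
    if f: "f \<in> ?Z" and ker: "?\<phi> f = ?\<phi> \<one>\<^bsub>bar (semidirect G) 3\<^esub>" for f
  proof -
    have "?a \<one>\<^bsub>bar (semidirect G) 3\<^esub> = \<one>\<^bsub>Tot (Apq G) 3\<^esub>" "?r \<one>\<^bsub>bar (semidirect G) 3\<^esub> = \<one>\<^bsub>bar G 3\<^esub>"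
      by (simp_all add: one_bar one_Tot shuffle_map_one A_part_one row_part_one)
    then have "?a f \<in> coboundaries (Tot (Apq G)) (Tot_d G) 3" "?r f \<in> coboundaries (bar G) (bar_d G) 3"
      using ker A.class_eq_one_iff[OF A.cocyclesD[OF a[OF f]]]
        R.class_eq_one_iff[OF R.cocyclesD[OF r[OF f]]] by auto
    then obtain y v where y: "y \<in> carrier (Tot (Apq G) 2)" "?a f = Tot_d G 2 y"
      and v: "v \<in> carrier (bar G 2)" "?r f = bar_d G 2 v"
      by (auto simp: coboundaries_3)
    \<comment> \<open>The cochains bounding the two components combine into one bounding the whole
      shuffle image, since both projections commute with the differentials.\<close>
    have Y: "glue 2 y v \<in> carrier (Tot (Cpq G) 2)" using y v glue_closed by blast
    have "shuffle_map G 3 f = Tot_d G 2 (glue 2 y v)"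
    proof (rule A_row_eqI[OF supported_shuffle_map])
      show "supported G 3 (Tot_d G 2 (glue 2 y v))" using supported_Tot_d[of G 2] by simp
      show "?a f = A_part 3 (Tot_d G 2 (glue 2 y v))"
        using A_part_Tot_d[OF Y] A_part_glue[OF y(1)] y(2) by simp
      show "?r f = row_part 3 (Tot_d G 2 (glue 2 y v))"
        using row_part_Tot_d[of 2 G "glue 2 y v"] v(2) by (simp add: row_part_glue)
    qed
    then show ?thesis using shuffle_map_coboundaryD[OF f Y] by blast
  qed
qed

end

section \<open>The cochains associated with a cocycle\<close>

text \<open>Extends \<open>abt\<close> from degree 3 to all degrees, so that compatibility with
  differentials can be stated; it is inherited from the pullback, the shuffle map and the
  projection.\<close>

definition mu_lift :: "('a, 'm) monoid_scheme \<Rightarrow> nat \<Rightarrow> ('a list \<Rightarrow> complex) \<Rightarrow> nat \<Rightarrow> 'a bicochain" where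
  "mu_lift G n w = A_part n (shuffle_map G n (pullback (semidirect G) (mu G) n w))"

lemma pullback_one: "pullback H \<phi> n (\<lambda>gs. 1) = (\<lambda>xs. 1)"
  by (auto simp: pullback_def)

lemma (in group) mu_pullback_hom:
  "pullback (semidirect G) (mu G) n \<in> hom (bar G n) (bar (semidirect G) n)"
  by (rule pullback_hom[OF group_semidirect is_group mu_hom])

lemma (in group) mu_pullback_closed:
  "w \<in> carrier (bar G n) \<Longrightarrow> pullback (semidirect G) (mu G) n w \<in> carrier (bar (semidirect G) n)"
  using mu_pullback_hom by (auto simp: hom_def)

lemma (in group) mu_lift_hom: "mu_lift G n \<in> hom (bar G n) (Tot (Apq G) n)"
proof -
  have "mu_lift G n = A_part n \<circ> (shuffle_map G n \<circ> pullback (semidirect G) (mu G) n)"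
    by (simp add: mu_lift_def fun_eq_iff)
  then show ?thesis
    using Group.hom_compose[OF Group.hom_compose[OF mu_pullback_hom shuffle_map_hom] A_part_hom] by simp
qed

lemma (in group) mu_lift_closed:
  "w \<in> carrier (bar G n) \<Longrightarrow> mu_lift G n w \<in> carrier (Tot (Apq G) n)"
  using mu_lift_hom by (auto simp: hom_def)

lemma (in group) mu_pullback_cocycle:
  assumes "w \<in> cocycles (bar G) (bar_d G) 3"
  shows "pullback (semidirect G) (mu G) 3 w \<in> cocycles (bar (semidirect G)) (bar_d (semidirect G)) 3"
  using assms pullback_bar_d[OF group_semidirect mu_hom, of 3 w]
  by (simp add: cocycles_3 mu_pullback_closed one_bar pullback_one)

lemma (in group) mu_lift_cocycle:
  "w \<in> cocycles (bar G) (bar_d G) 3 \<Longrightarrow> mu_lift G 3 w \<in> cocycles (Tot (Apq G)) (Tot_d G) 3"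
  unfolding mu_lift_def by (intro A_part_cocycle shuffle_map_cocycle mu_pullback_cocycle)

lemma (in group) mu_lift_bar_d:
  assumes "v \<in> carrier (bar G 2)"
  shows "mu_lift G 3 (bar_d G 2 v) = Tot_d G 2 (mu_lift G 2 v)"
  using pullback_bar_d[OF group_semidirect mu_hom, of 2 v] mu_pullback_closed[OF assms]
    shuffle_map_bar_d_2 A_part_Tot_d[of _ G 2] shuffle_map_closed
  by (simp add: mu_lift_def)

lemma (in group) mu_lift_0:
  assumes "w \<in> carrier (bar G n)" "n > 0"
  shows "mu_lift G n w 0 = (\<lambda>gs ks. if gs = [] then w ks else 1)"
proof (intro ext)
  fix gs ks :: "'a list"
  have "map (mu G \<circ> (\<lambda>k. (k, \<one>))) ks = ks" if "set ks \<subseteq> carrier G"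
    using that by (intro map_idI) (auto simp: mu_def)
  moreover have "shuffle_prod G f [] ks = f (map (\<lambda>k. (k, \<one>)) ks)" for f
    by (cases ks) simp_all
  moreover have "w ks = 1" if "\<not> (length ks = n \<and> set ks \<subseteq> carrier G)"
    using assms that by (auto simp: bar_def)
  ultimately show "mu_lift G n w 0 gs ks = (if gs = [] then w ks else 1)"
    using assms(2)
    by (auto simp: mu_lift_def A_part_def shuffle_map_def pullback_def semidirect_simps)
qed

text \<open>Each factor is one shuffle with \<mu> applied to its letters. For \<open>alpha\<close>
  these are (1,g)(1,h)(x,1) and (gh(x),1)(1,g)(1,h) with sign +1, and (1,g)(h(x),1)(1,h) with sign
  -1. The three factors of \<open>beta\<close> arise in the same way from one g and two k's.\<close>

lemma (in group) mu_lift_eq_abt: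
  assumes "w \<in> carrier (bar G 3)"
  shows "mu_lift G 3 w = abt G w"
proof (rule supported_3_eqI)
  show "supported G 3 (mu_lift G 3 w)"
    using mu_lift_closed[OF assms] supported_Tot by (auto simp: carrier_Tot_Apq)
  show "supported G 3 (abt G w)"
    using assms unfolding supported_def abt_def
    by (auto simp: alpha_def beta_def theta_def bar_def split: list.splits)
qed (simp_all add: mu_lift_def A_part_def shuffle_map_def pullback_def semidirect_simps cnj_act_simps
    mu_def abt_def theta_def beta_def alpha_def power_int_minus field_simps
    bar_nonzero[OF assms])

lemma (in group) row_part_mu_pullback:
  assumes "w \<in> carrier (bar G n)"
  shows "row_part n (shuffle_map G n (pullback (semidirect G) (mu G) n w)) = w"
proof
  fix gs
  have "map (mu G \<circ> Pair \<one>) gs = gs" if "set gs \<subseteq> carrier G"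
    using that by (intro map_idI) (auto simp: mu_def)
  moreover have "w gs = 1" if "\<not> (length gs = n \<and> set gs \<subseteq> carrier G)"
    using assms that by (auto simp: bar_def)
  ultimately show "row_part n (shuffle_map G n (pullback (semidirect G) (mu G) n w)) gs = w gs"
    by (auto simp: row_part_def shuffle_map_def pullback_def semidirect_simps)
qed

lemma (in group) canonical_iso_mu:
  assumes w: "w \<in> cocycles (bar G) (bar_d G) 3"
  shows "canonical_iso G 3 (pullback_class (semidirect G) (mu G) 3 (coh_class (bar G) (bar_d G) 3 w)) =
    (coh_class (Tot (Apq G)) (Tot_d G) 3 (abt G w), coh_class (bar G) (bar_d G) 3 w)"
proof -
  have w3: "w \<in> carrier (bar G 3)" using w by (simp add: cocycles_3)
  have "pullback (semidirect G) (mu G) 3 (bar_d G 2 v) =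
      bar_d (semidirect G) 2 (pullback (semidirect G) (mu G) 2 v)" for v
    using pullback_bar_d[OF group_semidirect mu_hom, of 2 v] by simp
  then have "pullback_class (semidirect G) (mu G) 3 (coh_class (bar G) (bar_d G) 3 w) =
      coh_class (bar (semidirect G)) (bar_d (semidirect G)) 3 (pullback (semidirect G) (mu G) 3 w)"
    unfolding pullback_class_def
    by (intro induced_map_class_3 cochain_degree_bar group.cochain_degree_bar[OF group_semidirect]
        mu_pullback_hom w3)
  then show ?thesis
    using mu_lift_eq_abt[OF w3] row_part_mu_pullback[OF w3]
    by (simp add: canonical_iso_class mu_pullback_closed[OF w3] mu_lift_def)
qed

section \<open>The column of bidegrees (0, q)\<close>

text \<open>The factor K is \<open>G\<close> as a group, so the column p = 0 is again the bar
  complex of \<open>G\<close>, now in the variables of K.\<close>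

lemma column_closed:
  assumes "F \<in> carrier (Tot (Cpq G) n)"
  shows "F 0 [] \<in> carrier (bar G n)"
  using Tot_CpqD[OF assms, of 0] by (simp add: Cpq_def bar_def)

lemma column_eq:
  assumes "F \<in> carrier (Tot (Cpq G) n)"
  shows "F 0 = (\<lambda>gs ks. if gs = [] then F 0 [] ks else 1)"
  using Tot_CpqD[OF assms, of 0] by (auto simp: Cpq_def fun_eq_iff)

lemma column_Tot_d: "Tot_d G n F 0 [] = bar_d G n (F 0 [])"
  by (rule ext) (simp add: Tot_d_def delta_K_def bar_d_def)

text \<open>Used twice for the last map: in degree 3 to produce a cocycle of \<open>Bpq\<close> for
  surjectivity, in degree 2 to move a bounding cochain into \<open>Bpq\<close> for
  injectivity.\<close>

lemma Bpq_quotient: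
  assumes F: "F \<in> carrier (Tot (Apq G) n)" and F': "F' \<in> carrier (Tot (Apq G) n)"
    and eq: "F 0 = F' 0" and n: "n > 0"
  shows "inv\<^bsub>Tot (Apq G) n\<^esub> F \<otimes>\<^bsub>Tot (Apq G) n\<^esub> F' \<in> carrier (Tot (Bpq G) n)"
proof -
  interpret A: comm_group "Tot (Apq G) n" by (rule comm_group_Tot)
  let ?Q = "inv\<^bsub>Tot (Apq G) n\<^esub> F \<otimes>\<^bsub>Tot (Apq G) n\<^esub> F'"
  have "F \<otimes>\<^bsub>Tot (Apq G) n\<^esub> ?Q = F'"
    using F F' by (simp flip: A.m_assoc)
  then have "(F \<otimes>\<^bsub>Tot (Apq G) n\<^esub> ?Q) 0 = F' 0"
    by (rule fun_cong)
  then have "F 0 gs ks * ?Q 0 gs ks = F' 0 gs ks" for gs ks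
    by (simp add: mult_Tot(2)[where F = F] fun_eq_iff)
  moreover have "F 0 gs ks \<noteq> 0" for gs ks
    using F Tot_nonzero[of F G n 0] by (simp add: carrier_Tot_Apq)
  ultimately have "?Q 0 = (\<lambda>gs ks. 1)"
    using eq by (metis mult_cancel_left1)
  moreover have "?Q \<in> carrier (Tot (Apq G) n)" using F F' by simp
  ultimately show ?thesis using n by (simp add: carrier_Tot_Apq carrier_Tot_Bpq)
qed

lemma cocycles_Bpq:
  "x \<in> cocycles (Tot (Bpq G)) (Tot_d G) 3 \<longleftrightarrow>
     x \<in> carrier (Tot (Bpq G) 3) \<and> x \<in> cocycles (Tot (Apq G)) (Tot_d G) 3"
  by (auto simp: cocycles_3 one_Tot carrier_Tot_Apq carrier_Tot_Bpq)

lemma Bpq_inclusion_hom: "id \<in> hom (Tot (Bpq G) n) (Tot (Apq G) n)"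
\<comment> \<open>The description of the carrier of \<open>Bpq\<close> is available for n > 0; in
  degree 0 both total groups are trivial.\<close>
proof (cases "n = 0")
  case True
  have "carrier (Tot (Bpq G) 0) = carrier (Tot (Apq G) 0)"
    by (simp add: Tot_def Apq_def Bpq_def)
  then show ?thesis using True by (simp add: hom_def mult_Tot)
qed (auto simp: hom_def mult_Tot carrier_Tot_Apq carrier_Tot_Bpq)

lemma (in group) column_cocycle:
  assumes a: "a \<in> cocycles (Tot (Apq G)) (Tot_d G) 3"
  shows "a 0 [] \<in> cocycles (bar G) (bar_d G) 3"
  using a column_closed[of a G 3] column_Tot_d[of G 3 a]
  by (simp add: cocycles_3 carrier_Tot_Apq one_Tot one_bar)

lemma (in group) mu_lift_column:
  assumes a: "a \<in> carrier (Tot (Apq G) n)" and n: "n > 0"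
  shows "mu_lift G n (a 0 []) 0 = a 0"
proof -
  have "a \<in> carrier (Tot (Cpq G) n)" using a by (simp add: carrier_Tot_Apq)
  then show ?thesis
    using mu_lift_0[OF column_closed n] column_eq[of a G n] by simp
qed

theorem (in group) mu_lift_iso:
  fixes \<Psi>
  defines "\<Psi> \<equiv> \<lambda>(c, e).
    induced_map (Tot (Apq G)) (Tot_d G) 3 (mu_lift G 3) c \<otimes>\<^bsub>H_Tot G (Apq G) 3\<^esub>
    induced_map (Tot (Apq G)) (Tot_d G) 3 id e"
  shows "\<Psi> \<in> iso (H_group G 3 \<times>\<times> H_Tot G (Bpq G) 3) (H_Tot G (Apq G) 3)"
    and "w \<in> cocycles (bar G) (bar_d G) 3 \<Longrightarrow> x \<in> cocycles (Tot (Bpq G)) (Tot_d G) 3 \<Longrightarrow>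
      \<Psi> (coh_class (bar G) (bar_d G) 3 w, coh_class (Tot (Bpq G)) (Tot_d G) 3 x) =
      coh_class (Tot (Apq G)) (Tot_d G) 3 (mu_lift G 3 w) \<otimes>\<^bsub>H_Tot G (Apq G) 3\<^esub>
      coh_class (Tot (Apq G)) (Tot_d G) 3 x"
proof -
  interpret A: cochain_degree "Tot (Apq G)" "Tot_d G" 3 by (rule cochain_degree_Tot)
  interpret A3: comm_group "Tot (Apq G) 3" by (rule comm_group_Tot)
  interpret A2: comm_group "Tot (Apq G) 2" by (rule comm_group_Tot)
  interpret ZA: subgroup "cocycles (Tot (Apq G)) (Tot_d G) 3" "Tot (Apq G) 3"
    by (rule A.cocycles_subgroup)
  let ?clsA = "coh_class (Tot (Apq G)) (Tot_d G) 3"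
  let ?\<phi> = "\<lambda>w x. ?clsA (mu_lift G 3 w \<otimes>\<^bsub>Tot (Apq G) 3\<^esub> x)"
  have BA: "x \<in> cocycles (Tot (Apq G)) (Tot_d G) 3" "x \<in> carrier (Tot (Apq G) 3)"
    if "x \<in> cocycles (Tot (Bpq G)) (Tot_d G) 3" for x
    using that A.cocyclesD by (auto simp: cocycles_Bpq)
  have L: "mu_lift G 3 w \<in> cocycles (Tot (Apq G)) (Tot_d G) 3" "mu_lift G 3 w \<in> carrier (Tot (Apq G) 3)"
    if "w \<in> cocycles (bar G) (bar_d G) 3" for w
    using that mu_lift_cocycle A.cocyclesD by auto
  have \<Psi>: "\<Psi> (coh_class (bar G) (bar_d G) 3 w, coh_class (Tot (Bpq G)) (Tot_d G) 3 x) =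
      ?clsA (mu_lift G 3 w) \<otimes>\<^bsub>H_Tot G (Apq G) 3\<^esub> ?clsA x"
    if "w \<in> cocycles (bar G) (bar_d G) 3" "x \<in> cocycles (Tot (Bpq G)) (Tot_d G) 3" for w x
  proof -
    have "induced_map (Tot (Apq G)) (Tot_d G) 3 (mu_lift G 3) (coh_class (bar G) (bar_d G) 3 w) =
        ?clsA (mu_lift G 3 w)"
      using that(1) by (intro induced_map_class_3 cochain_degree_bar cochain_degree_Tot mu_lift_hom mu_lift_bar_d)
        (auto simp: cocycles_3)
    moreover have "induced_map (Tot (Apq G)) (Tot_d G) 3 id (coh_class (Tot (Bpq G)) (Tot_d G) 3 x) =
        ?clsA (id x)"
      using that(2)
      by (intro induced_map_class_3[where \<phi> = "\<lambda>n. id"] cochain_degree_Tot Bpq_inclusion_hom)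
        (auto simp: cocycles_3)
    ultimately show ?thesis by (simp add: \<Psi>_def)
  qed
  then show "w \<in> cocycles (bar G) (bar_d G) 3 \<Longrightarrow> x \<in> cocycles (Tot (Bpq G)) (Tot_d G) 3 \<Longrightarrow>
      \<Psi> (coh_class (bar G) (bar_d G) 3 w, coh_class (Tot (Bpq G)) (Tot_d G) 3 x) =
      ?clsA (mu_lift G 3 w) \<otimes>\<^bsub>H_Tot G (Apq G) 3\<^esub> ?clsA x" .
  have L_mult: "mu_lift G n (w \<otimes>\<^bsub>bar G n\<^esub> w') = mu_lift G n w \<otimes>\<^bsub>Tot (Apq G) n\<^esub> mu_lift G n w'"
    if "w \<in> carrier (bar G n)" "w' \<in> carrier (bar G n)" for w w' n
    using hom_mult[OF mu_lift_hom that] .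
  have L_one: "mu_lift G n \<one>\<^bsub>bar G n\<^esub> = \<one>\<^bsub>Tot (Apq G) n\<^esub>" for n
    by (simp add: mu_lift_def one_bar one_Tot pullback_one shuffle_map_one A_part_one)
  show "\<Psi> \<in> iso (H_group G 3 \<times>\<times> H_Tot G (Bpq G) 3) (H_Tot G (Apq G) 3)"
  proof (rule iso_cohomology_pairI[OF cochain_degree_bar cochain_degree_Tot(3)])
    show "\<Psi> (coh_class (bar G) (bar_d G) 3 w, coh_class (Tot (Bpq G)) (Tot_d G) 3 x) = ?\<phi> w x"
      if "w \<in> cocycles (bar G) (bar_d G) 3" "x \<in> cocycles (Tot (Bpq G)) (Tot_d G) 3" for w x
      using that \<Psi> L BA by (simp add: A.mult_class)
  next
    fix w x w' x'
    assume w: "w \<in> cocycles (bar G) (bar_d G) 3" "w' \<in> cocycles (bar G) (bar_d G) 3"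
      and x: "x \<in> cocycles (Tot (Bpq G)) (Tot_d G) 3" "x' \<in> cocycles (Tot (Bpq G)) (Tot_d G) 3"
    have "mu_lift G 3 (w \<otimes>\<^bsub>bar G 3\<^esub> w') = mu_lift G 3 w \<otimes>\<^bsub>Tot (Apq G) 3\<^esub> mu_lift G 3 w'"
      using w by (intro L_mult) (simp_all add: cocycles_3)
    moreover have "x \<otimes>\<^bsub>Tot (Bpq G) 3\<^esub> x' = x \<otimes>\<^bsub>Tot (Apq G) 3\<^esub> x'"
      by (simp add: mult_Tot)
    ultimately show "?\<phi> (w \<otimes>\<^bsub>bar G 3\<^esub> w') (x \<otimes>\<^bsub>Tot (Bpq G) 3\<^esub> x') =
        ?\<phi> w x \<otimes>\<^bsub>H_Tot G (Apq G) 3\<^esub> ?\<phi> w' x'"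
      using L(2)[OF w(1)] L(2)[OF w(2)] BA(2)[OF x(1)] BA(2)[OF x(2)]
      by (simp add: A.mult_class A3.m_ac)
  next
    show "(\<lambda>(w, x). ?\<phi> w x) ` (cocycles (bar G) (bar_d G) 3 \<times> cocycles (Tot (Bpq G)) (Tot_d G) 3) =
        carrier (H_Tot G (Apq G) 3)"
    proof
      show "(\<lambda>(w, x). ?\<phi> w x) ` (cocycles (bar G) (bar_d G) 3 \<times> cocycles (Tot (Bpq G)) (Tot_d G) 3)
          \<subseteq> carrier (H_Tot G (Apq G) 3)"
        using L BA by (auto simp: A.carrier_cohomology)
      show "carrier (H_Tot G (Apq G) 3) \<subseteq>
          (\<lambda>(w, x). ?\<phi> w x) ` (cocycles (bar G) (bar_d G) 3 \<times> cocycles (Tot (Bpq G)) (Tot_d G) 3)"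
      proof
        fix u assume "u \<in> carrier (H_Tot G (Apq G) 3)"
        then obtain a where a: "a \<in> cocycles (Tot (Apq G)) (Tot_d G) 3" and u: "u = ?clsA a"
          by (auto simp: A.carrier_cohomology)
        have a3: "a \<in> carrier (Tot (Apq G) 3)" by (rule A.cocyclesD[OF a])
        let ?w = "a 0 []"
        let ?x = "inv\<^bsub>Tot (Apq G) 3\<^esub> (mu_lift G 3 ?w) \<otimes>\<^bsub>Tot (Apq G) 3\<^esub> a"
        have w: "?w \<in> cocycles (bar G) (bar_d G) 3" by (rule column_cocycle[OF a])
        have "?x \<in> cocycles (Tot (Bpq G)) (Tot_d G) 3"
          unfolding cocycles_Bpq
          using Bpq_quotient[OF L(2)[OF w] a3 mu_lift_column[OF a3]] L(1)[OF w] a by simp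
        moreover have "mu_lift G 3 ?w \<otimes>\<^bsub>Tot (Apq G) 3\<^esub> ?x = a"
          using L(2)[OF w] a3 by (simp flip: A3.m_assoc)
        ultimately show "u \<in> (\<lambda>(w, x). ?\<phi> w x) `
            (cocycles (bar G) (bar_d G) 3 \<times> cocycles (Tot (Bpq G)) (Tot_d G) 3)"
          using w u by (intro image_eqI[of _ _ "(?w, ?x)"]) auto
      qed
    qed
  next
    fix w x
    assume w: "w \<in> cocycles (bar G) (bar_d G) 3" and x: "x \<in> cocycles (Tot (Bpq G)) (Tot_d G) 3"
      and ker: "?\<phi> w x = ?\<phi> \<one>\<^bsub>bar G 3\<^esub> \<one>\<^bsub>Tot (Bpq G) 3\<^esub>"
    note Lw = L(2)[OF w] and xA = BA(2)[OF x]
    have "\<one>\<^bsub>Tot (Bpq G) 3\<^esub> = \<one>\<^bsub>Tot (Apq G) 3\<^esub>" by (simp add: one_Tot)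
    then have "mu_lift G 3 w \<otimes>\<^bsub>Tot (Apq G) 3\<^esub> x \<in> coboundaries (Tot (Apq G)) (Tot_d G) 3"
      using ker A.class_eq_one_iff[OF A3.m_closed[OF Lw xA]] by (simp add: L_one)
    then obtain y where y: "y \<in> carrier (Tot (Apq G) 2)"
      and eq: "mu_lift G 3 w \<otimes>\<^bsub>Tot (Apq G) 3\<^esub> x = Tot_d G 2 y"
      by (auto simp: coboundaries_3)
    \<comment> \<open>The column of \<open>y\<close> bounds \<open>w\<close>: \<open>x\<close> is
      trivial in the column, where the lift of \<open>w\<close> is \<open>w\<close>.\<close>
    let ?v = "y 0 []"
    have v: "?v \<in> carrier (bar G 2)"
      using y column_closed by (auto simp: carrier_Tot_Apq)
    have "w = bar_d G 2 ?v"
    proof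
      fix ks
      have "x 0 = (\<lambda>gs ks. 1)" using x by (simp add: cocycles_3 carrier_Tot_Bpq)
      moreover have "mu_lift G 3 w 0 [] ks = w ks"
        using w mu_lift_0[of w 3] by (simp add: cocycles_3)
      ultimately have "(mu_lift G 3 w \<otimes>\<^bsub>Tot (Apq G) 3\<^esub> x) 0 [] ks = w ks"
        by (simp add: mult_Tot)
      then show "w ks = bar_d G 2 ?v ks"
        by (simp add: eq column_Tot_d)
    qed
    then have w_eq: "mu_lift G 3 w = Tot_d G 2 (mu_lift G 2 ?v)"
      using mu_lift_bar_d[OF v] by simp
    let ?s = "mu_lift G 2 ?v"
    \<comment> \<open>\<open>y\<close> may have a nontrivial column. Dividing by the lift of that
      column puts it into \<open>Bpq\<close>, and the factor removed from its differential is
      exactly \<open>mu_lift G 3 w\<close>, which leaves \<open>x\<close>.\<close>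
    let ?z = "inv\<^bsub>Tot (Apq G) 2\<^esub> ?s \<otimes>\<^bsub>Tot (Apq G) 2\<^esub> y"
    have s: "?s \<in> carrier (Tot (Apq G) 2)" by (rule mu_lift_closed[OF v])
    have z: "?z \<in> carrier (Tot (Bpq G) 2)"
      using Bpq_quotient[OF s y mu_lift_column[OF y]] by simp
    have zA: "?z \<in> carrier (Tot (Apq G) 2)" using s y by simp
    have Dz: "Tot_d G 2 ?z \<in> carrier (Tot (Apq G) 3)"
      using hom_in_carrier[OF Tot_d_2_hom(2) zA] .
    have "?s \<otimes>\<^bsub>Tot (Apq G) 2\<^esub> ?z = y"
      using s y by (simp flip: A2.m_assoc)
    then have "Tot_d G 2 ?s \<otimes>\<^bsub>Tot (Apq G) 3\<^esub> Tot_d G 2 ?z = Tot_d G 2 y"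
      using hom_mult[OF Tot_d_2_hom(2) s zA] by simp
    then have "x = Tot_d G 2 ?z"
      using eq Lw xA Dz A3.Units_l_cancel[of "Tot_d G 2 ?s" x "Tot_d G 2 ?z"] by (simp add: w_eq A3.Units_eq)
    then have "x \<in> coboundaries (Tot (Bpq G)) (Tot_d G) 3"
      using z unfolding coboundaries_3 by blast
    moreover have "w \<in> coboundaries (bar G) (bar_d G) 3"
      using \<open>w = bar_d G 2 ?v\<close> v unfolding coboundaries_3 by blast
    ultimately show "w \<in> coboundaries (bar G) (bar_d G) 3 \<and> x \<in> coboundaries (Tot (Bpq G)) (Tot_d G) 3"
      by simp
  qed
qed

theorem proposition3p15:
  fixes G :: "('a, 'm) monoid_scheme"
  assumes "group G"
  shows
    "canonical_iso G 3 \<in> iso (H_group (semidirect G) 3) (H_Tot G (Apq G) 3 \<times>\<times> H_group G 3) \<and>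
     (\<forall>w \<in> cocycles (bar G) (bar_d G) 3.
        (coh_class (Tot (Apq G)) (Tot_d G) 3 (abt G w), coh_class (bar G) (bar_d G) 3 w) =
        canonical_iso G 3
          (pullback_class (semidirect G) (mu G) 3 (coh_class (bar G) (bar_d G) 3 w))) \<and>
     (\<exists>\<Psi> \<in> iso (H_group G 3 \<times>\<times> H_Tot G (Bpq G) 3) (H_Tot G (Apq G) 3).
        \<forall>w \<in> cocycles (bar G) (bar_d G) 3. \<forall>x \<in> cocycles (Tot (Bpq G)) (Tot_d G) 3.
          \<Psi> (coh_class (bar G) (bar_d G) 3 w, coh_class (Tot (Bpq G)) (Tot_d G) 3 x) =
          coh_class (Tot (Apq G)) (Tot_d G) 3 (abt G w) \<otimes>\<^bsub>H_Tot G (Apq G) 3\<^esub>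
          coh_class (Tot (Apq G)) (Tot_d G) 3 x)"
proof -
  interpret group G by fact
  \<comment> \<open>Passes from the lift, for which the isomorphism was proved, to the explicit
    cochains of the statement.\<close>
  have "mu_lift G 3 w = abt G w" if "w \<in> cocycles (bar G) (bar_d G) 3" for w
    using that by (intro mu_lift_eq_abt) (simp add: cocycles_3)
  then show ?thesis
    using canonical_iso_iso canonical_iso_mu mu_lift_iso by (auto intro!: bexI[OF _ mu_lift_iso(1)])
qed

end
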